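(* Let $M,E\in\mathcal{K}^n$ with $\dim(E)=n$, and let $K=M+E$ (Minkowski sum). For $0\leq i\leq j\leq n$ put $$f_i^{(j)}=\sum_{k=0}^{n-j}\binom{n-j}{k}(-1)^k\,\mathrm{W}_{i+k}(K;E).$$ Then, for every choice of integers $0\leq i\leq j\leq n$, $$f_i^{(j)}\geq 0.$$ Equality holds if and only if $\dim(M)\leq n-j-1$.
   Context: $\mathcal{K}^n$ denotes the set of all convex bodies in $\mathbb{R}^n$, i.e., all non-empty compact convex subsets of $\mathbb{R}^n$. The dimension $\dim(\cdot)$ of a convex body is the dimension of its affine hull (so it is always $\geq 0$). For $K,E\in\mathcal{K}^n$, the relative quermassintegrals $\mathrm{W}_i(K;E)$, $0\leq i\leq n$, are the coefficients defined by the relative Steiner formula $\mathrm{vol}(K+\lambda E)=\sum_{i=0}^n\binom{n}{i}\mathrm{W}_i(K;E)\lambda^i$ for all $\lambda\geq 0$, where $\mathrm{vol}$ is Lebesgue measure and $+$ is Minkowski addition; that is, $\mathrm{W}_i(K;E)$ is the mixed volume with $K$ appearing $n-i$ times and $E$ appearing $i$ times. The superscript in $f_i^{(j)}$ is only an index. *)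

theory Defs
  imports "HOL-Analysis.Analysis"
begin

definition convex_body :: "'a::euclidean_space set \<Rightarrow> bool" where
  "convex_body K \<longleftrightarrow> K \<noteq> {} \<and> compact K \<and> convex K"

text \<open>
  \<open>quermassintegral K E i\<close> is the relative quermassintegral \<open>W\<^sub>i(K;E)\<close>. The relative Steiner formula
  is required to hold for all \<open>r \<ge> 0\<close> with \<open>n = DIM('a)\<close>; this determines \<open>w 0, \<dots>, w n\<close>, since a
  real polynomial is determined by its values on the nonnegative reals. The values of \<open>w\<close> beyond
  \<open>n\<close> do not occur in the formula and are set to \<open>0\<close> so that \<open>w\<close> is unique as a function on \<open>nat\<close>.
\<close>
definition quermassintegral :: "'a::euclidean_space set \<Rightarrow> 'a set \<Rightarrow> nat \<Rightarrow> real" where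
  "quermassintegral K E = (THE w.
     (\<forall>r\<ge>0. measure lebesgue (K + (\<lambda>x. r *\<^sub>R x) ` E)
             = (\<Sum>i = 0..DIM('a). real (DIM('a) choose i) * w i * r ^ i)) \<and>
     (\<forall>i>DIM('a). w i = 0))"

end

theory Submission
  imports Defs
begin

text \<open>
  Write \<open>vol (M + r E) = (\<Sum>i\<le>n. (n choose i) w\<^sub>i r ^ i)\<close>. Since \<open>K + r E = M + (1 + r) E\<close>, the
  quermassintegrals of \<open>K\<close> are \<open>W\<^sub>i(K;E) = (\<Sum>l\<le>n-i. (n-i choose l) w\<^sub>i\<^sub>+\<^sub>l)\<close>, and the alternating sum
  undoes \<open>n - j\<close> of these binomial steps: it equals \<open>(\<Sum>l\<le>j-i. (j-i choose l) w\<^sub>i\<^sub>+\<^sub>l)\<close>. It remains to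
  see that \<open>w\<^sub>i \<ge> 0\<close>, with equality exactly if \<open>dim M < n - i\<close>.

  For polytopes \<open>M = conv A\<close>, \<open>E = conv B\<close> this comes from a mixed subdivision. Lift \<open>A\<close> and \<open>B\<close> to
  the vectors \<open>(a, 1, 0)\<close> and \<open>(b, 0, 1)\<close>, and consider the linear program of minimizing a generic
  cost among the nonnegative representations of \<open>(x, 1, r)\<close>. The dual feasible bases do not depend
  on \<open>(x, 1, r)\<close>, and their cones tile the whole cone; so \<open>M + r E\<close> is tiled by cells
  \<open>conv A' + r conv B'\<close>, each of volume proportional to \<open>r ^ (card B' - 1)\<close>. A basis of cost zero
  is dual feasible if the other costs are positive; so any full-dimensional cell may be prescribed,
  which yields lower bounds for the coefficients. These survive the approximation of \<open>M\<close> and \<open>E\<close> by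
  increasing sequences of polytopes that all contain the prescribed cell.
\<close>

section \<open>Dual feasible bases of a generic linear program\<close>

text \<open>If \<open>y \<bullet> v = c v\<close> on a dependent set, every linear relation of that
  set also annihilates the costs. Costs \<open>t ^ idx v\<close> off \<open>B\<close> turn each such
  condition into a polynomial equation in \<open>t\<close>, and the finitely many roots are avoided.
  The zero costs on \<open>B\<close> later allow a cell to be prescribed.\<close>

lemma generic_cost:
  fixes A B :: "'w::euclidean_space set"
  assumes fin: "finite A" and indep: "independent B"
  obtains c :: "'w \<Rightarrow> real" where "\<And>v. v \<in> B \<Longrightarrow> c v = 0" and "\<And>v. v \<notin> B \<Longrightarrow> 0 < c v"
    and "\<And>y. independent {v \<in> A. y \<bullet> v = c v}"
proof -
  obtain idx :: "'w \<Rightarrow> nat" where idx: "inj_on idx A"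
    using finite_imp_inj_to_nat_seg[OF fin] by blast
  have ex: "\<exists>u. (\<exists>v\<in>T. u v \<noteq> 0) \<and> (\<Sum>v\<in>T. u v *\<^sub>R v) = 0"
    if "T \<subseteq> A" "dependent T" for T
    using dependent_finite[OF finite_subset[OF that(1) fin]] that(2) by blast
  define u where "u T = (SOME u. (\<exists>v\<in>T. u v \<noteq> 0) \<and> (\<Sum>v\<in>T. u v *\<^sub>R v) = 0)" for T :: "'w set"
  have u: "(\<exists>v\<in>T. u T v \<noteq> 0) \<and> (\<Sum>v\<in>T. u T v *\<^sub>R v) = 0" if "T \<subseteq> A" "dependent T" for T
    unfolding u_def using ex[OF that] by (rule someI_ex)
  define p where "p T = (\<Sum>v\<in>T - B. monom (u T v :: real) (idx v))" for T
  have p_nz: "p T \<noteq> 0" if T: "T \<subseteq> A" "dependent T" for T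
  proof -
    have fT: "finite T" using fin T finite_subset by blast
    \<comment> \<open>A relation supported in \<open>B\<close> alone would contradict the
      independence of \<open>B\<close>. As \<open>idx\<close> is injective on \<open>A\<close>, the
      surviving coefficient appears unchanged in \<open>p T\<close>.\<close>
    have "\<exists>v\<in>T - B. u T v \<noteq> 0"
    proof (rule ccontr)
      assume "\<not> ?thesis"
      then have z: "\<And>v. v \<in> T - B \<Longrightarrow> u T v = 0" by blast
      have "(\<Sum>v\<in>T \<inter> B. u T v *\<^sub>R v) = (\<Sum>v\<in>T. u T v *\<^sub>R v)"
        by (rule sum.mono_neutral_left) (use fT z in auto)
      then have "(\<Sum>v\<in>T \<inter> B. u T v *\<^sub>R v) = 0" using u[OF T] by simp
      moreover have "\<exists>v\<in>T \<inter> B. u T v \<noteq> 0" using u[OF T] z by blast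
      ultimately have "dependent (T \<inter> B)" using fT dependent_finite[of "T \<inter> B"] by blast
      then show False using indep dependent_mono by blast
    qed
    then obtain v where v: "v \<in> T - B" "u T v \<noteq> 0" by blast
    have "coeff (p T) (idx v) = (\<Sum>w\<in>T - B. if w = v then u T w else 0)"
      unfolding p_def coeff_sum coeff_monom
      by (rule sum.cong) (use v T idx in \<open>auto simp: inj_on_def\<close>)
    also have "\<dots> = u T v" using v fT by simp
    finally show ?thesis using v by auto
  qed
  define R where "R = (\<Union>T\<in>{T. T \<subseteq> A \<and> dependent T}. {x. poly (p T) x = 0})"
  have "finite R"
    unfolding R_def using fin p_nz by (auto intro!: finite_subset[of _ "Pow A"] poly_roots_finite)
  then have "infinite ({0<..} - R)" by (intro Diff_infinite_finite infinite_Ioi)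
  then obtain t where t: "0 < t" "t \<notin> R"
    using infinite_imp_nonempty by blast
  define c where "c v = (if v \<in> B then 0 else t ^ idx v)" for v
  show thesis
  proof
    fix y
    let ?T = "{v \<in> A. y \<bullet> v = c v}"
    show "independent ?T"
    proof (rule ccontr)
      assume dep: "\<not> independent ?T"
      have sub: "?T \<subseteq> A" by blast
      have fT: "finite ?T" using fin by simp
      have "poly (p ?T) t = (\<Sum>v\<in>?T - B. u ?T v * c v)"
        unfolding p_def poly_sum poly_monom c_def by (rule sum.cong) auto
      also have "\<dots> = (\<Sum>v\<in>?T. u ?T v * c v)"
        by (rule sum.mono_neutral_left) (use fT in \<open>auto simp: c_def\<close>)
      also have "\<dots> = y \<bullet> (\<Sum>v\<in>?T. u ?T v *\<^sub>R v)"
        unfolding inner_sum_right inner_scaleR_right by (rule sum.cong) auto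
      also have "\<dots> = 0" using u[OF sub] dep by simp
      finally have "t \<in> R" unfolding R_def using dep sub by blast
      then show False using t by blast
    qed
  qed (use t in \<open>auto simp: c_def\<close>)
qed

definition nonneg_span :: "'w::real_vector set \<Rightarrow> 'w set" where
  "nonneg_span B = {x. \<exists>l. (\<forall>v\<in>B. 0 \<le> l v) \<and> x = (\<Sum>v\<in>B. l v *\<^sub>R v)}"

text \<open>
  A dual feasible basis of the linear program
  \<open>minimize (\<Sum>v\<in>A. c v * l v) subject to l \<ge> 0 and (\<Sum>v\<in>A. l v *\<^sub>R v) = x\<close>;
  the condition does not depend on \<open>x\<close>.
\<close>
definition dual_basis :: "'w::euclidean_space set \<Rightarrow> ('w \<Rightarrow> real) \<Rightarrow> 'w set \<Rightarrow> bool" where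
  "dual_basis A c B \<longleftrightarrow> span B = UNIV \<and>
     (\<exists>y. B = {v \<in> A. y \<bullet> v = c v} \<and> (\<forall>v\<in>A. y \<bullet> v \<le> c v))"

text \<open>Complementary slackness: the dual solutions \<open>y\<close> and \<open>y'\<close> of
  the two bases are both optimal for \<open>x\<close>, so a representation of \<open>x\<close> over
  \<open>B\<close> uses only vectors that are tight for \<open>y'\<close> as well. Hence two cells
  meet only in the span of their common vectors.\<close>

lemma dual_basis_nonneg_span_inter:
  assumes fin: "finite A" and B: "dual_basis A c B" and B': "dual_basis A c B'"
    and x: "x \<in> nonneg_span B" "x \<in> nonneg_span B'"
  shows "x \<in> span (B \<inter> B')"
proof -
  obtain y where y: "B = {v \<in> A. y \<bullet> v = c v}" "\<And>v. v \<in> A \<Longrightarrow> y \<bullet> v \<le> c v"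
    using B unfolding dual_basis_def by blast
  obtain y' where y': "B' = {v \<in> A. y' \<bullet> v = c v}" "\<And>v. v \<in> A \<Longrightarrow> y' \<bullet> v \<le> c v"
    using B' unfolding dual_basis_def by blast
  have finB: "finite B" "finite B'" using fin y y' by auto
  obtain l where l: "\<And>v. v \<in> B \<Longrightarrow> 0 \<le> l v" "x = (\<Sum>v\<in>B. l v *\<^sub>R v)"
    using x(1) unfolding nonneg_span_def by blast
  obtain l' where l': "\<And>v. v \<in> B' \<Longrightarrow> 0 \<le> l' v" "x = (\<Sum>v\<in>B'. l' v *\<^sub>R v)"
    using x(2) unfolding nonneg_span_def by blast
  have "y \<bullet> x = (\<Sum>v\<in>B'. l' v * (y \<bullet> v))"
    unfolding l'(2) by (simp add: inner_sum_right)
  also have "\<dots> \<le> (\<Sum>v\<in>B'. l' v * (y' \<bullet> v))"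
    using l'(1) y y' by (intro sum_mono mult_left_mono) auto
  also have "\<dots> = y' \<bullet> x" unfolding l'(2) by (simp add: inner_sum_right)
  finally have "0 \<le> y' \<bullet> x - y \<bullet> x" by simp
  also have "\<dots> = (\<Sum>v\<in>B. l v * (y' \<bullet> v - y \<bullet> v))"
    unfolding l(2) by (simp add: inner_sum_right sum_subtractf right_diff_distrib)
  finally have "(\<Sum>v\<in>B. l v * (y \<bullet> v - y' \<bullet> v)) \<le> 0"
    by (simp add: right_diff_distrib sum_subtractf)
  moreover have nn: "\<And>v. v \<in> B \<Longrightarrow> 0 \<le> l v * (y \<bullet> v - y' \<bullet> v)"
    using l(1) y y' by (intro mult_nonneg_nonneg) auto
  ultimately have "(\<Sum>v\<in>B. l v * (y \<bullet> v - y' \<bullet> v)) = 0"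
    by (meson antisym sum_nonneg)
  then have "\<And>v. v \<in> B \<Longrightarrow> l v = 0 \<or> y \<bullet> v = y' \<bullet> v"
    using sum_nonneg_eq_0_iff[OF finB(1) nn] by auto
  then have "\<And>v. v \<in> B - B' \<Longrightarrow> l v = 0" using y y' by force
  then have "x = (\<Sum>v\<in>B \<inter> B'. l v *\<^sub>R v)"
    unfolding l(2) by (intro sum.mono_neutral_right finB) auto
  moreover have "(\<Sum>v\<in>B \<inter> B'. l v *\<^sub>R v) \<in> span (B \<inter> B')"
    by (intro span_sum span_scale span_base)
  ultimately show ?thesis by simp
qed

text \<open>The vectors with positive weight in a representation of \<open>x\<close> span the space
  by genericity. On each of them \<open>y\<close> is bounded above by the cost, and below because
  \<open>0 \<le> y \<bullet> x\<close> while all other terms of the sum are bounded above.\<close>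

lemma dual_polyhedron_bounded:
  fixes A :: "'w::euclidean_space set"
  assumes fin: "finite A" and x: "x \<in> nonneg_span A"
    and gen: "\<And>C. C \<subseteq> A \<Longrightarrow> span C \<noteq> UNIV \<Longrightarrow> x \<notin> span C"
  shows "bounded {y. (\<forall>v\<in>A. y \<bullet> v \<le> c v) \<and> 0 \<le> y \<bullet> x}"
proof -
  obtain l where l: "\<And>v. v \<in> A \<Longrightarrow> 0 \<le> l v" "x = (\<Sum>v\<in>A. l v *\<^sub>R v)"
    using x unfolding nonneg_span_def by blast
  define P where "P = {v \<in> A. 0 < l v}"
  define D where "D = {y. (\<forall>v\<in>A. y \<bullet> v \<le> c v) \<and> 0 \<le> y \<bullet> x}"
  have D: "\<And>y v. y \<in> D \<Longrightarrow> v \<in> A \<Longrightarrow> y \<bullet> v \<le> c v" "\<And>y. y \<in> D \<Longrightarrow> 0 \<le> y \<bullet> x"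
    unfolding D_def by auto
  have "l v = 0" if "v \<in> A - P" for v
    using l(1)[of v] that by (auto simp: P_def)
  then have "x = (\<Sum>v\<in>P. l v *\<^sub>R v)"
    unfolding l(2) by (intro sum.mono_neutral_right fin) (auto simp: P_def)
  also have "\<dots> \<in> span P"
    by (intro span_sum span_scale span_base)
  finally have sp: "span P = UNIV" using gen[of P] by (auto simp: P_def)
  have bd: "\<exists>k. \<forall>y\<in>D. \<bar>y \<bullet> v\<bar> \<le> k" if "v \<in> P" for v
  proof (intro exI ballI)
    have v: "v \<in> A" "0 < l v" using that by (auto simp: P_def)
    fix y assume y: "y \<in> D"
    let ?S = "\<Sum>u\<in>A - {v}. l u * c u"
    have "0 \<le> (\<Sum>u\<in>A. l u * (y \<bullet> u))"
      using D(2)[OF y] unfolding l(2) by (simp add: inner_sum_right)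
    also have "\<dots> = l v * (y \<bullet> v) + (\<Sum>u\<in>A - {v}. l u * (y \<bullet> u))"
      by (rule sum.remove[OF fin v(1)])
    finally have "0 \<le> l v * (y \<bullet> v) + (\<Sum>u\<in>A - {v}. l u * (y \<bullet> u))" .
    moreover have "(\<Sum>u\<in>A - {v}. l u * (y \<bullet> u)) \<le> ?S"
      using D(1)[OF y] l(1) by (intro sum_mono mult_left_mono) auto
    ultimately have "- ?S \<le> l v * (y \<bullet> v)" by linarith
    then have "- (?S / l v) \<le> y \<bullet> v" using v(2) by (simp add: field_simps)
    moreover have "y \<bullet> v \<le> c v" using D(1)[OF y v(1)] .
    ultimately show "\<bar>y \<bullet> v\<bar> \<le> \<bar>?S / l v\<bar> + \<bar>c v\<bar>" by linarith
  qed
  have "\<exists>k. \<forall>y\<in>D. \<bar>y \<bullet> z\<bar> \<le> k" for z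
  proof -
    have "z \<in> span P" using sp by simp
    then show ?thesis
    proof (induction rule: span_induct_alt)
      case base
      then show ?case by (auto intro!: exI[of _ 0])
    next
      case (step a v z)
      obtain k where k: "\<And>y. y \<in> D \<Longrightarrow> \<bar>y \<bullet> v\<bar> \<le> k"
        using bd[OF step(1)] by blast
      obtain k' where k': "\<And>y. y \<in> D \<Longrightarrow> \<bar>y \<bullet> z\<bar> \<le> k'"
        using step(2) by blast
      have "\<bar>y \<bullet> (a *\<^sub>R v + z)\<bar> \<le> \<bar>a\<bar> * k + k'" if "y \<in> D" for y
      proof -
        have "\<bar>y \<bullet> (a *\<^sub>R v + z)\<bar> \<le> \<bar>a * (y \<bullet> v)\<bar> + \<bar>y \<bullet> z\<bar>"
          unfolding inner_add_right inner_scaleR_right by (rule abs_triangle_ineq)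
        also have "\<bar>a * (y \<bullet> v)\<bar> \<le> \<bar>a\<bar> * k"
          unfolding abs_mult using k[OF that] by (rule mult_left_mono) simp
        finally show ?thesis using k'[OF that] by simp
      qed
      then show ?case by blast
    qed
  qed
  then have "\<forall>z. \<exists>k. \<forall>y\<in>D. \<bar>y \<bullet> z\<bar> \<le> k" by blast
  from choice[OF this] obtain k where k: "\<And>z y. y \<in> D \<Longrightarrow> \<bar>y \<bullet> z\<bar> \<le> k z" by blast
  show ?thesis
    unfolding bounded_iff D_def[symmetric]
  proof (intro exI ballI)
    fix y assume "y \<in> D"
    then have "(\<Sum>b\<in>Basis. \<bar>y \<bullet> b\<bar>) \<le> (\<Sum>b\<in>Basis. k b)"
      by (intro sum_mono k)
    then show "norm y \<le> (\<Sum>b\<in>Basis. k b)" using norm_le_l1[of y] by linarith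
  qed
qed

text \<open>Linear programming duality: maximize \<open>y \<bullet> x\<close> over the dual feasible
  set, cut off by \<open>0 \<le> y \<bullet> x\<close> to be compact and nonempty as it contains
  \<open>0\<close>. The constraints tight at a maximizer form the basis.\<close>

lemma exists_dual_basis:
  fixes A :: "'w::euclidean_space set"
  assumes fin: "finite A" and c: "\<And>v. v \<in> A \<Longrightarrow> 0 \<le> c v"
    and indep: "\<And>y. independent {v \<in> A. y \<bullet> v = c v}"
    and x: "x \<in> nonneg_span A"
    and gen: "\<And>C. C \<subseteq> A \<Longrightarrow> span C \<noteq> UNIV \<Longrightarrow> x \<notin> span C"
  obtains B where "dual_basis A c B" "x \<in> nonneg_span B"
proof -
  define D where "D = {y. (\<forall>v\<in>A. y \<bullet> v \<le> c v) \<and> 0 \<le> y \<bullet> x}"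
  have "D = (\<Inter>v\<in>A. {y. v \<bullet> y \<le> c v}) \<inter> {y. 0 \<le> x \<bullet> y}"
    by (auto simp: inner_commute D_def)
  then have "closed D"
    by (simp add: closed_INT closed_halfspace_le closed_Int closed_halfspace_ge)
  moreover have "bounded D"
    unfolding D_def using fin x gen by (rule dual_polyhedron_bounded)
  ultimately have "compact D" by (simp add: compact_eq_bounded_closed)
  moreover have "0 \<in> D" using c by (auto simp: D_def)
  moreover have "continuous_on D (\<lambda>y. y \<bullet> x)" by (intro continuous_intros)
  ultimately obtain y where y: "y \<in> D" and max: "\<And>z. z \<in> D \<Longrightarrow> z \<bullet> x \<le> y \<bullet> x"
    using continuous_attains_sup[of D "\<lambda>y. y \<bullet> x"] by blast
  define B where "B = {v \<in> A. y \<bullet> v = c v}"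
  \<comment> \<open>Otherwise a small move from \<open>y\<close> along \<open>z\<close> stays
    feasible, since constraints outside \<open>B\<close> have slack, and it increases the
    objective.\<close>
  have improve: "\<exists>v\<in>B. 0 < z \<bullet> v" if z: "0 < z \<bullet> x" for z
  proof (rule ccontr)
    assume neg: "\<not> ?thesis"
    have "\<forall>\<^sub>F e in at_right 0. \<forall>v\<in>A. (y + e *\<^sub>R z) \<bullet> v \<le> c v"
      unfolding eventually_ball_finite_distrib[OF fin]
    proof
      fix v assume v: "v \<in> A"
      show "\<forall>\<^sub>F e in at_right 0. (y + e *\<^sub>R z) \<bullet> v \<le> c v"
      proof (cases "v \<in> B")
        case True
        then have "z \<bullet> v \<le> 0" using neg by force
        have "\<forall>\<^sub>F e in at_right (0::real). 0 < e" by (rule eventually_at_right_less)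
        then show ?thesis
        proof eventually_elim
          case (elim e)
          then show ?case
            using True[unfolded B_def] \<open>z \<bullet> v \<le> 0\<close> by (simp add: inner_add_left mult_nonneg_nonpos)
        qed
      next
        case False
        then have "y \<bullet> v < c v" using y v by (force simp: B_def D_def)
        have "((\<lambda>e. (y + e *\<^sub>R z) \<bullet> v) \<longlongrightarrow> (y + 0 *\<^sub>R z) \<bullet> v) (at_right 0)"
          by (intro tendsto_intros)
        then have "\<forall>\<^sub>F e in at_right 0. (y + e *\<^sub>R z) \<bullet> v < c v"
          using \<open>y \<bullet> v < c v\<close> by (intro order_tendstoD(2)) auto
        then show ?thesis by eventually_elim simp
      qed
    qed
    moreover have "\<forall>\<^sub>F e in at_right (0::real). 0 < e" by (rule eventually_at_right_less)
    ultimately have "\<forall>\<^sub>F e in at_right 0. 0 < e \<and> (\<forall>v\<in>A. (y + e *\<^sub>R z) \<bullet> v \<le> c v)"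
      by eventually_elim simp
    then have "\<exists>e. 0 < e \<and> (\<forall>v\<in>A. (y + e *\<^sub>R z) \<bullet> v \<le> c v)"
      by (rule eventually_happens'[rotated]) simp
    then obtain e where e: "0 < e" "\<forall>v\<in>A. (y + e *\<^sub>R z) \<bullet> v \<le> c v"
      by blast
    then have "y + e *\<^sub>R z \<in> D" using y z by (auto simp: inner_add_left D_def)
    from max[OF this] show False using mult_pos_pos[OF e(1) z] by (simp add: inner_add_left)
  qed
  have perp: "\<exists>z. z \<bullet> x > 0 \<and> (\<forall>v\<in>span S. z \<bullet> v = 0)" if "x \<notin> span S" for S
  proof -
    obtain s z where s: "s \<in> span S" and z: "\<And>w. w \<in> span S \<Longrightarrow> orthogonal z w" and xs: "x = s + z"
      using orthogonal_subspace_decomp_exists[of S x] by blast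
    have "z \<noteq> 0" using that s xs by auto
    moreover have "z \<bullet> x = z \<bullet> z" using z[OF s] xs by (simp add: inner_add_right orthogonal_def)
    ultimately show ?thesis using z by (intro exI[of _ z]) (auto simp: orthogonal_def)
  qed
  have sp: "span B = UNIV"
  proof (rule ccontr)
    assume "span B \<noteq> UNIV"
    then have "x \<notin> span B" using gen[of B] by (auto simp: B_def)
    then obtain z where z: "z \<bullet> x > 0" "\<forall>v\<in>span B. z \<bullet> v = 0" using perp by blast
    then obtain v where v: "v \<in> B" "0 < z \<bullet> v" using improve by blast
    then have "z \<bullet> v = 0" using bspec[OF z(2) span_base] by simp
    then show False using v by simp
  qed
  have finB: "finite B" using fin by (simp add: B_def)
  have "x \<in> span B" using sp by simp
  then obtain l where l: "x = (\<Sum>v\<in>B. l v *\<^sub>R v)"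
    using span_finite[OF finB] by auto
  \<comment> \<open>With a negative coefficient at \<open>u\<close>, the component of
    \<open>x\<close> orthogonal to the other vectors of \<open>B\<close> is an increasing direction
    that has a negative product with \<open>u\<close> and product zero with the rest, against
    \<open>improve\<close>.\<close>
  have "0 \<le> l u" if u: "u \<in> B" for u
  proof (rule ccontr)
    assume neg: "\<not> 0 \<le> l u"
    have split: "x = l u *\<^sub>R u + (\<Sum>v\<in>B - {u}. l v *\<^sub>R v)"
      unfolding l using finB u by (rule sum.remove)
    have rest: "(\<Sum>v\<in>B - {u}. l v *\<^sub>R v) \<in> span (B - {u})"
      by (intro span_sum span_scale span_base)
    have "u \<notin> span (B - {u})" using indep[of y] u unfolding dependent_def B_def[symmetric] by blast
    then have "l u *\<^sub>R u \<notin> span (B - {u})" using neg span_scale[of "l u *\<^sub>R u" "B - {u}" "inverse (l u)"] by auto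
    then have "x \<notin> span (B - {u})"
      unfolding split using span_add_eq2[OF rest] by blast
    then obtain z where z: "z \<bullet> x > 0" "\<forall>v\<in>span (B - {u}). z \<bullet> v = 0" using perp by blast
    then have "z \<bullet> x = l u * (z \<bullet> u)"
      by (subst split) (simp add: inner_add_right rest)
    then have "z \<bullet> u < 0" using z neg by (auto simp: zero_less_mult_iff)
    obtain v where v: "v \<in> B" "0 < z \<bullet> v" using improve[OF z(1)] by blast
    then have "v \<in> B - {u}" using \<open>z \<bullet> u < 0\<close> by auto
    then have "z \<bullet> v = 0" using bspec[OF z(2) span_base] by simp
    then show False using v by simp
  qed
  then have "x \<in> nonneg_span B" unfolding nonneg_span_def using l by blast
  moreover have "dual_basis A c B" unfolding dual_basis_def using sp y unfolding B_def D_def by blast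
  ultimately show thesis using that by blast
qed

section \<open>The Cayley embedding\<close>

abbreviation outer :: "'a::real_vector set \<Rightarrow> 'a set \<Rightarrow> real \<Rightarrow> 'a set" where
  "outer K E r \<equiv> K + (\<lambda>x. r *\<^sub>R x) ` E"

lemma compact_outer:
  fixes K E :: "'a::real_normed_vector set" and r :: real
  assumes "compact K" "compact E"
  shows "compact (outer K E r)"
proof -
  have "compact {x + y | x y. x \<in> K \<and> y \<in> (\<lambda>x. r *\<^sub>R x) ` E}"
    using assms by (intro compact_sums compact_scaling)
  also have "{x + y | x y. x \<in> K \<and> y \<in> (\<lambda>x. r *\<^sub>R x) ` E} = outer K E r"
    by (auto simp: set_plus_def)
  finally show ?thesis .
qed

lemma convex_outer: "convex K \<Longrightarrow> convex E \<Longrightarrow> convex (outer K E r)"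
  by (intro convex_set_plus convex_scaling)

lemma outer_mono: "K \<subseteq> K' \<Longrightarrow> E \<subseteq> E' \<Longrightarrow> outer K E r \<subseteq> outer K' E' r"
  by (intro set_plus_mono2 image_mono)

text \<open>
  The Cayley embedding: the sections of the cone over \<open>lift A B\<close> by \<open>{(x, 1, r)}\<close> are the bodies
  \<open>convex hull A + r * convex hull B\<close>.
\<close>
definition lift :: "'a::real_vector set \<Rightarrow> 'a set \<Rightarrow> ('a \<times> real \<times> real) set" where
  "lift A B = (\<lambda>a. (a, 1, 0)) ` A \<union> (\<lambda>b. (b, 0, 1)) ` B"

lemma mem_lift [simp]:
  "(x, 1, 0) \<in> lift A B \<longleftrightarrow> x \<in> A" "(x, 0, 1) \<in> lift A B \<longleftrightarrow> x \<in> B"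
  by (auto simp: lift_def)

lemma finite_lift [simp]: "finite A \<Longrightarrow> finite B \<Longrightarrow> finite (lift A B)"
  by (simp add: lift_def)

lemma lift_mono: "A \<subseteq> A' \<Longrightarrow> B \<subseteq> B' \<Longrightarrow> lift A B \<subseteq> lift A' B'"
  by (auto simp: lift_def)

lemma lift_inject: "lift A B = lift A' B' \<longleftrightarrow> A = A' \<and> B = B'"
  by (metis mem_lift subsetI subset_antisym)

lemma subset_lift_eq:
  assumes "C \<subseteq> lift A B"
  obtains A' B' where "A' \<subseteq> A" "B' \<subseteq> B" "C = lift A' B'"
proof
  show "C = lift {a \<in> A. (a, 1, 0) \<in> C} {b \<in> B. (b, 0, 1) \<in> C}"
    using assms by (auto simp: lift_def)
qed auto

lemma sum_lift:
  assumes "finite A" "finite B"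
  shows "sum g (lift A B) = (\<Sum>a\<in>A. g (a, 1, 0)) + (\<Sum>b\<in>B. g (b, 0, 1))"
  unfolding lift_def using assms
  by (subst sum.union_disjoint) (auto simp: sum.reindex inj_on_def)

lemma card_lift: "finite A \<Longrightarrow> finite B \<Longrightarrow> card (lift A B) = card A + card B"
  using sum_lift[of A B "\<lambda>_. 1::nat"] by simp

lemma lin_comb_lift:
  assumes "finite A" "finite B"
  shows "(\<Sum>v\<in>lift A B. l v *\<^sub>R v) =
    ((\<Sum>a\<in>A. l (a, 1, 0) *\<^sub>R a) + (\<Sum>b\<in>B. l (b, 0, 1) *\<^sub>R b),
      \<Sum>a\<in>A. l (a, 1, 0), \<Sum>b\<in>B. l (b, 0, 1))"
  using assms by (simp add: sum_lift prod_eq_iff fst_sum snd_sum)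

text \<open>The last two coordinates force the weights on \<open>A\<close> to sum to
  \<open>1\<close> and those on \<open>B\<close> to sum to \<open>r\<close>; dividing the latter by
  \<open>r\<close> gives convex combinations.\<close>

lemma nonneg_span_lift:
  assumes fin: "finite A" "finite B" and r: "0 < r"
  shows "(x, 1, r) \<in> nonneg_span (lift A B) \<longleftrightarrow> x \<in> outer (convex hull A) (convex hull B) r"
proof
  assume "(x, 1, r) \<in> nonneg_span (lift A B)"
  then obtain l where l: "\<forall>v\<in>lift A B. 0 \<le> l v" and eq: "(x, 1, r) = (\<Sum>v\<in>lift A B. l v *\<^sub>R v)"
    unfolding nonneg_span_def by blast
  define y where "y = (\<Sum>a\<in>A. l (a, 1, 0) *\<^sub>R a)"
  define z where "z = (\<Sum>b\<in>B. (l (b, 0, 1) / r) *\<^sub>R b)"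
  have s: "(\<Sum>a\<in>A. l (a, 1, 0)) = 1" "(\<Sum>b\<in>B. l (b, 0, 1)) = r"
    and x: "x = y + (\<Sum>b\<in>B. l (b, 0, 1) *\<^sub>R b)"
    using eq unfolding lin_comb_lift[OF fin] y_def by auto
  have "r *\<^sub>R z = (\<Sum>b\<in>B. l (b, 0, 1) *\<^sub>R b)"
    unfolding z_def scaleR_right.sum using r by simp
  then have "x = y + r *\<^sub>R z" using x by simp
  moreover have "y \<in> convex hull A"
    unfolding convex_hull_finite[OF fin(1)] y_def using l s
    by (intro CollectI exI[of _ "\<lambda>a. l (a, 1, 0)"]) auto
  moreover have "z \<in> convex hull B"
    unfolding convex_hull_finite[OF fin(2)] z_def using l s r
    by (intro CollectI exI[of _ "\<lambda>b. l (b, 0, 1) / r"]) (auto simp: sum_divide_distrib[symmetric])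
  ultimately show "x \<in> outer (convex hull A) (convex hull B) r" by auto
next
  assume "x \<in> outer (convex hull A) (convex hull B) r"
  then obtain y z where yz: "y \<in> convex hull A" "z \<in> convex hull B" and x: "x = y + r *\<^sub>R z"
    by (auto elim!: set_plus_elim)
  obtain u where u: "\<And>a. a \<in> A \<Longrightarrow> 0 \<le> u a" "sum u A = 1" "y = (\<Sum>a\<in>A. u a *\<^sub>R a)"
    using yz(1) unfolding convex_hull_finite[OF fin(1)] by blast
  obtain w where w: "\<And>b. b \<in> B \<Longrightarrow> 0 \<le> w b" "sum w B = 1" "z = (\<Sum>b\<in>B. w b *\<^sub>R b)"
    using yz(2) unfolding convex_hull_finite[OF fin(2)] by blast
  \<comment> \<open>The second coordinate tells the copy of \<open>A\<close> from the copy of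
    \<open>B\<close>, even for points common to both.\<close>
  define l where "l v = (if fst (snd v) = (1::real) then u (fst v) else r * w (fst v))"
    for v :: "'a \<times> real \<times> real"
  have "\<forall>v\<in>lift A B. 0 \<le> l v" using u(1) w(1) r by (auto simp: lift_def l_def)
  moreover have "(x, 1, r) = (\<Sum>v\<in>lift A B. l v *\<^sub>R v)"
    unfolding lin_comb_lift[OF fin] x u(3) w(3) using u(2) w(2)
    by (simp add: l_def scaleR_right.sum flip: sum_distrib_left)
  ultimately show "(x, 1, r) \<in> nonneg_span (lift A B)" unfolding nonneg_span_def by blast
qed

section \<open>Spans, independence and sections of lifted point sets\<close>

lemma span_lift_nonempty:
  fixes A B :: "'a::real_vector set"
  assumes "span (lift A B) = UNIV"
  shows "A \<noteq> {}" "B \<noteq> {}"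
proof -
  have "subspace {v :: 'a \<times> real \<times> real. fst (snd v) = 0}"
    and "subspace {v :: 'a \<times> real \<times> real. snd (snd v) = 0}"
    by (auto simp: subspace_def)
  then have "span (lift {} B) \<subseteq> {v. fst (snd v) = 0}" "span (lift A {}) \<subseteq> {v. snd (snd v) = 0}"
    by (intro span_minimal; auto simp: lift_def)+
  moreover have "(0, 1, 1) \<in> span (lift A B)" using assms by simp
  ultimately show "A \<noteq> {}" "B \<noteq> {}" by fastforce+
qed

text \<open>Homogenization: the constant coordinate \<open>1\<close> turns linear relations of the
  lifted points into affine relations of \<open>A\<close>.\<close>

lemma independent_lift_empty_iff:
  assumes "finite A"
  shows "independent (lift A {}) \<longleftrightarrow> \<not> affine_dependent A"
proof
  assume ind: "independent (lift A {})"
  show "\<not> affine_dependent A"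
  proof
    assume "affine_dependent A"
    then obtain u where u: "sum u A = 0" "\<exists>v\<in>A. u v \<noteq> 0" "(\<Sum>v\<in>A. u v *\<^sub>R v) = 0"
      using affine_dependent_explicit_finite[OF assms] by blast
    then have "(\<Sum>v\<in>lift A {}. u (fst v) *\<^sub>R v) = 0"
      using lin_comb_lift[OF assms finite.emptyI, of "\<lambda>v. u (fst v)"] by (simp add: zero_prod_def)
    moreover have "\<exists>v\<in>lift A {}. u (fst v) \<noteq> 0" using u(2) by (auto simp: lift_def)
    ultimately show False using ind dependent_finite[of "lift A {}"] assms by auto
  qed
next
  assume na: "\<not> affine_dependent A"
  show "independent (lift A {})"
  proof (rule ccontr)
    assume "\<not> ?thesis"
    then obtain l where l: "\<exists>v\<in>lift A {}. l v \<noteq> 0" "(\<Sum>v\<in>lift A {}. l v *\<^sub>R v) = 0"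
      using dependent_finite[of "lift A {}"] assms by auto
    have "\<exists>a\<in>A. l (a, 1, 0) \<noteq> 0" using l(1) by (auto simp: lift_def)
    moreover have "(\<Sum>a\<in>A. l (a, 1, 0)) = 0" "(\<Sum>a\<in>A. l (a, 1, 0) *\<^sub>R a) = 0"
      using l(2) unfolding lin_comb_lift[OF assms finite.emptyI] by (simp_all add: zero_prod_def)
    ultimately show False
      using na affine_dependent_explicit_finite[OF assms] by blast
  qed
qed

text \<open>The points \<open>x\<close> with \<open>(x, 0, 1)\<close> in the span form an affine set
  containing \<open>E\<close>, hence the whole space; differences of such vectors remove the last
  coordinate.\<close>

lemma span_lift_right:
  fixes E :: "'a::euclidean_space set"
  assumes "aff_dim E = DIM('a)"
  shows "(x, 0, t) \<in> span (lift A E)"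
proof -
  have "affine {x. (x, 0, 1) \<in> span (lift A E)}"
    unfolding affine_def
  proof (intro ballI allI impI, unfold mem_Collect_eq)
    fix x y :: 'a and u v :: real
    assume xy: "(x, 0, 1) \<in> span (lift A E)" "(y, 0, 1) \<in> span (lift A E)" and uv: "u + v = 1"
    have "u *\<^sub>R (x, 0, 1) + v *\<^sub>R (y, 0, 1) \<in> span (lift A E)"
      using xy by (intro span_add span_scale)
    then show "(u *\<^sub>R x + v *\<^sub>R y, 0, 1) \<in> span (lift A E)" using uv by simp
  qed
  then have "affine hull E \<subseteq> {x. (x, 0, 1) \<in> span (lift A E)}"
    by (intro hull_minimal) (auto intro!: span_base)
  then have sec: "(x, 0, 1) \<in> span (lift A E)" for x
    using assms aff_dim_eq_full[of E] by auto
  show ?thesis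
    using span_add[OF span_diff[OF sec[of x] sec[of 0]] span_scale[OF sec[of 0], of t]] by simp
qed

lemma span_lift_eq_UNIV:
  fixes E :: "'a::euclidean_space set"
  assumes "A \<noteq> {}" and "aff_dim E = DIM('a)"
  shows "span (lift A E) = UNIV"
proof -
  obtain a where a: "a \<in> A" using assms by blast
  have "(x, s, t) \<in> span (lift A E)" for x s t
  proof -
    have "s *\<^sub>R (a, 1, 0) + (x - s *\<^sub>R a, 0, t) \<in> span (lift A E)"
      using a by (intro span_add span_scale span_base span_lift_right assms) auto
    then show ?thesis by simp
  qed
  then show ?thesis by auto
qed

text \<open>A proper span has a normal vector \<open>(p, q, t)\<close>, so its section lies in the
  set \<open>p \<bullet> x = - (q + t * r)\<close>, which is null unless the equation is
  trivial.\<close>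

lemma negligible_span_lift_section:
  fixes A B :: "'a::euclidean_space set"
  assumes "span (lift A B) \<noteq> UNIV" and r: "0 < r"
  shows "negligible {x. (x, 1, r) \<in> span (lift A B)}"
proof -
  obtain z where z: "z \<noteq> 0" "\<forall>v\<in>span (lift A B). z \<bullet> v = 0"
    using span_not_UNIV_orthogonal assms by blast
  obtain p q t where pqt: "z = (p, q, t)" by (cases z)
  show ?thesis
  proof (cases "p \<noteq> 0 \<or> - (q + t * r) \<noteq> 0")
    case True
    have "{x. (x, 1, r) \<in> span (lift A B)} \<subseteq> {x. p \<bullet> x = - (q + t * r)}"
      using z(2) by (force simp: pqt inner_prod_def)
    then show ?thesis using negligible_hyperplane[OF True] negligible_subset by blast
  next
    \<comment> \<open>Here the normal is a nonzero multiple of \<open>(0, - r, 1)\<close>, which is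
      orthogonal to no lifted vector. So the lift is empty and the section is empty too.\<close>
    case False
    then have p: "p = 0" and q: "q = - (t * r)" by auto
    then have "t \<noteq> 0" "q \<noteq> 0" using z(1) r by (auto simp: pqt zero_prod_def)
    have "lift A B = {}"
    proof (rule ccontr)
      assume "lift A B \<noteq> {}"
      then obtain v where v: "v \<in> lift A B" by blast
      then have "z \<bullet> v = 0" using z(2) span_base by blast
      then show False using v \<open>t \<noteq> 0\<close> \<open>q \<noteq> 0\<close> p by (auto simp: lift_def pqt inner_prod_def)
    qed
    then show ?thesis by (simp add: zero_prod_def)
  qed
qed

text \<open>A null convex cell lies in a hyperplane with some normal \<open>a\<close>. Then
  \<open>a\<close> is constant on \<open>A\<close> and on \<open>B\<close> separately, and
  correcting it by these two constants gives a nonzero vector orthogonal to the whole lift.\<close>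

lemma measure_outer_cell_pos:
  fixes A B :: "'a::euclidean_space set"
  assumes fin: "finite A" "finite B" and sp: "span (lift A B) = UNIV"
  shows "0 < measure lebesgue (outer (convex hull A) (convex hull B) 1)"
proof -
  let ?S = "outer (convex hull A) (convex hull B) 1"
  have cS: "compact ?S"
    using fin by (intro compact_outer finite_imp_compact_convex_hull)
  have vS: "convex ?S"
    by (rule convex_outer[OF convex_convex_hull convex_convex_hull])
  have "\<not> negligible ?S"
  proof
    assume "negligible ?S"
    then have "interior ?S = {}" using vS negligible_convex_interior by blast
    then obtain a b where a: "a \<noteq> 0" and sub: "?S \<subseteq> {x. a \<bullet> x = b}"
      using empty_interior_subset_hyperplane vS by blast
    obtain a0 b0 where a0: "a0 \<in> A" and b0: "b0 \<in> B" using span_lift_nonempty[OF sp] by blast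
    have ab: "a \<bullet> p + a \<bullet> q = b" if "p \<in> A" "q \<in> B" for p q
    proof -
      have "p + q \<in> ?S" using that by (simp add: set_plus_intro hull_inc)
      then show ?thesis using sub by (auto simp: inner_add_right)
    qed
    define z where "z = (a, - (a \<bullet> a0), - (a \<bullet> b0))"
    have "lift A B \<subseteq> {v. z \<bullet> v = 0}"
    proof
      fix v assume "v \<in> lift A B"
      then show "v \<in> {v. z \<bullet> v = 0}"
        using ab[OF _ b0] ab[OF a0] ab[OF a0 b0] by (force simp: lift_def z_def inner_prod_def)
    qed
    then have "span (lift A B) \<subseteq> {v. z \<bullet> v = 0}" by (intro span_minimal subspace_hyperplane)
    then have "z \<bullet> z = 0" using sp by blast
    then have "z = 0" by simp
    then show False using a by (simp add: z_def zero_prod_def)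
  qed
  moreover have "?S \<in> lmeasurable" using cS lmeasurable_compact by blast
  ultimately show ?thesis
    using negligible_iff_measure zero_less_measure_iff by blast
qed

section \<open>Volumes of linear images\<close>

text \<open>
  The pushforward of Lebesgue measure under a linear bijection is translation invariant, so Fubini
  compares it with Lebesgue measure.
\<close>
lemma emeasure_vimage_linear_mult:
  fixes h :: "'a::euclidean_space \<Rightarrow> 'a"
  assumes lin: "linear h" and surj: "surj h" and [measurable]: "S \<in> sets borel" "T \<in> sets borel"
  shows "emeasure lborel (h -` S) * emeasure lborel T = emeasure lborel (h -` T) * emeasure lborel S"
proof -
  have [measurable]: "h \<in> borel_measurable borel"
    using lin by (intro borel_measurable_continuous_onI linear_continuous_on)
      (simp add: linear_conv_bounded_linear)
  have shift: "(\<integral>\<^sup>+x. g (c + x) \<partial>lborel) = (\<integral>\<^sup>+x. g x \<partial>lborel)"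
    if [measurable]: "g \<in> borel_measurable borel" for g :: "'a \<Rightarrow> ennreal" and c
    by (subst (2) lborel_distr_plus[symmetric, of c]) (simp add: nn_integral_distr)
  have vim: "(\<integral>\<^sup>+x. indicator U (h x) \<partial>lborel) = emeasure lborel (h -` U)"
    if [measurable]: "U \<in> sets borel" for U
  proof -
    have "h -` U \<inter> space borel \<in> sets borel" by (intro measurable_sets[where A = borel]) auto
    then have "h -` U \<in> sets lborel" by simp
    moreover have "(\<lambda>x. indicator U (h x) :: ennreal) = indicator (h -` U)"
      by (auto simp: indicator_def)
    ultimately show ?thesis by simp
  qed
  have "emeasure lborel (h -` S) * emeasure lborel T
      = (\<integral>\<^sup>+x. indicator S (h x) * (\<integral>\<^sup>+y. indicator T y \<partial>lborel) \<partial>lborel)"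
    by (simp add: nn_integral_multc vim)
  also have "\<dots> = (\<integral>\<^sup>+x. (\<integral>\<^sup>+y. indicator S (h x) * indicator T (h x + y) \<partial>lborel) \<partial>lborel)"
    by (simp add: nn_integral_cmult shift del: nn_integral_indicator)
  also have "\<dots> = (\<integral>\<^sup>+y. (\<integral>\<^sup>+x. indicator S (h x) * indicator T (h x + y) \<partial>lborel) \<partial>lborel)"
    by (rule lborel_pair.Fubini'[symmetric]) measurable
  also have "\<dots> = (\<integral>\<^sup>+y. (\<integral>\<^sup>+x. indicator S (h x - y) * indicator T (h x) \<partial>lborel) \<partial>lborel)"
  proof (rule nn_integral_cong)
    fix y :: 'a
    \<comment> \<open>Translating the source by \<open>z\<close> translates the image by
      \<open>- y\<close>; this is the translation invariance of the pushforward.\<close>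
    obtain z where z: "h z = - y" using surj by (metis surjD)
    have "(\<integral>\<^sup>+x. indicator S (h x) * indicator T (h x + y) \<partial>lborel)
        = (\<integral>\<^sup>+x. indicator S (h (z + x)) * indicator T (h (z + x) + y) \<partial>lborel)"
      by (rule shift[symmetric]) measurable
    then show "(\<integral>\<^sup>+x. indicator S (h x) * indicator T (h x + y) \<partial>lborel)
        = (\<integral>\<^sup>+x. indicator S (h x - y) * indicator T (h x) \<partial>lborel)"
      by (simp add: linear_add[OF lin] z)
  qed
  also have "\<dots> = (\<integral>\<^sup>+x. (\<integral>\<^sup>+y. indicator S (h x - y) * indicator T (h x) \<partial>lborel) \<partial>lborel)"
    by (rule lborel_pair.Fubini') measurable
  also have "\<dots> = (\<integral>\<^sup>+x. (\<integral>\<^sup>+y. indicator S (- y) \<partial>lborel) * indicator T (h x) \<partial>lborel)"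
  proof (rule nn_integral_cong)
    fix x :: 'a
    have "(\<integral>\<^sup>+y. indicator S (h x - y) * indicator T (h x) \<partial>lborel)
        = (\<integral>\<^sup>+y. indicator S (h x - (h x + y)) * indicator T (h x) \<partial>lborel)"
      by (rule shift[symmetric]) measurable
    then show "(\<integral>\<^sup>+y. indicator S (h x - y) * indicator T (h x) \<partial>lborel)
        = (\<integral>\<^sup>+y. indicator S (- y) \<partial>lborel) * indicator T (h x)"
      by (simp add: nn_integral_multc)
  qed
  also have "\<dots> = (\<integral>\<^sup>+y. indicator S (- y) \<partial>lborel) * emeasure lborel (h -` T)"
    by (simp add: nn_integral_cmult vim)
  also have "(\<integral>\<^sup>+y. indicator S (- y) \<partial>lborel) = (\<integral>\<^sup>+y. indicator S y \<partial>distr lborel borel uminus)"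
    by (simp add: nn_integral_distr del: nn_integral_indicator)
  also have "distr lborel borel uminus = (lborel :: 'a measure)"
    using lborel_affine[of "-1" "0 :: 'a"] by (simp add: density_1 one_ennreal_def[symmetric])
  also have "(\<integral>\<^sup>+y. indicator S y \<partial>lborel) = emeasure lborel S" by simp
  finally show ?thesis by (simp add: mult.commute)
qed

text \<open>Comparison with the unit cube yields the factor. Its value is left open, because it
  cancels when \<open>P\<close> is used for a change of basis.\<close>

lemma emeasure_linear_image_proportional:
  fixes P :: "'a::euclidean_space \<Rightarrow> 'a"
  assumes lin: "linear P" and inj: "inj P"
  obtains k where "\<And>C. compact C \<Longrightarrow> emeasure lborel (P ` C) = k * emeasure lborel C"
proof -
  obtain h where h: "linear h" "\<And>x. h (P x) = x" "\<And>x. P (h x) = x"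
    using linear_injective_isomorphism[OF lin inj] by blast
  have vim: "h -` C = P ` C" for C by (auto simp: h(2,3) image_iff intro!: bexI[of _ "h _"])
  have one: "emeasure lborel (cbox 0 (One :: 'a)) = 1"
    by (subst emeasure_lborel_cbox) auto
  have "surj h" using h(2) by (metis surjI)
  have "emeasure lborel (P ` C) = emeasure lborel (h -` cbox 0 One) * emeasure lborel C" if "compact C" for C
    using emeasure_vimage_linear_mult[OF h(1) \<open>surj h\<close>, of C "cbox 0 One"] that
    unfolding one vim by (simp add: borel_compact)
  then show thesis by (rule that)
qed

text \<open>Diagonalization: \<open>L\<close> is conjugate to the diagonal map \<open>D\<close> by
  the map \<open>P\<close> that sends the standard basis to \<open>S\<close>. The volume factors of
  \<open>P\<close> and its inverse cancel.\<close>

lemma measure_eigenbasis: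
  fixes L :: "'a::euclidean_space \<Rightarrow> 'a"
  assumes lin: "linear L" and sp: "span S = UNIV" and card: "card S = DIM('a)"
    and eig: "\<And>v. v \<in> S \<Longrightarrow> L v = d v *\<^sub>R v" and pos: "\<And>v. v \<in> S \<Longrightarrow> 0 < d v" and C: "compact C"
  shows "measure lebesgue (L ` C) = prod d S * measure lebesgue C"
proof -
  have "finite S" using card by (metis card.infinite DIM_positive less_irrefl)
  then obtain h where h: "bij_betw h (Basis :: 'a set) S"
    using finite_same_card_bij[OF finite_Basis] card by metis
  have hS: "h j \<in> S" if "j \<in> Basis" for j using h that by (auto simp: bij_betw_def)
  obtain P :: "'a \<Rightarrow> 'a" where P: "linear P" "\<And>b. b \<in> Basis \<Longrightarrow> P b = h b"
    using linear_independent_extend[OF independent_Basis, of h] by blast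
  have "range P = span (P ` Basis)" using linear_span_image[OF P(1), of Basis] by simp
  also have "P ` Basis = S" using P(2) h by (auto simp: bij_betw_def image_iff)
  finally have "inj P" using sp linear_surjective_imp_injective[OF P(1)] by simp
  define D where "D x = (\<Sum>j\<in>Basis. (d (h j) * (x \<bullet> j)) *\<^sub>R j)" for x :: 'a
  have linD: "linear D"
    unfolding D_def by (intro linear_compose_sum ballI linearI) (auto simp: inner_add_left algebra_simps)
  have Db: "D b = d (h b) *\<^sub>R b" if "b \<in> Basis" for b
    using that unfolding D_def by (subst sum.remove[OF finite_Basis that]) (auto simp: inner_Basis intro!: sum.neutral split: if_splits)
  have comm: "L (P x) = P (D x)" for x
  proof -
    have "linear (L \<circ> P)" using P(1) lin by (rule linear_compose)
    moreover have "linear (P \<circ> D)" using linD P(1) by (rule linear_compose)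
    moreover have "(L \<circ> P) b = (P \<circ> D) b" if "b \<in> Basis" for b
      using that by (simp add: P(2) Db eig hS linear_scale[OF P(1)])
    ultimately have "L \<circ> P = P \<circ> D" by (rule linear_eq_stdbasis)
    then have "(L \<circ> P) x = (P \<circ> D) x" by (rule fun_cong)
    then show ?thesis by simp
  qed
  have Dinv: "D -` D ` X = X" for X
  proof -
    have coord: "x \<bullet> b = (D x \<bullet> b) / d (h b)" if b: "b \<in> Basis" for x b
    proof -
      have "D x \<bullet> b = d (h b) * (x \<bullet> b)"
        unfolding D_def using b by (simp add: inner_sum_left inner_Basis if_distrib cong: if_cong)
      then show ?thesis using pos[OF hS[OF b]] by simp
    qed
    have "inj D"
    proof (rule injI)
      fix x y :: 'a assume eq: "D x = D y"
      show "x = y"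
        by (rule euclidean_eqI) (simp only: coord[of _ x] coord[of _ y] eq)
    qed
    then show ?thesis by (rule inj_vimage_image_eq)
  qed
  have contD: "continuous_on A D" for A
    using linD by (simp add: linear_conv_bounded_linear linear_continuous_on)
  have eD: "emeasure lborel (D ` X) = ennreal (prod d S) * emeasure lborel X" if X: "compact X" for X
  proof -
    have cD: "compact (D ` X)" using X contD by (rule compact_continuous_image[rotated])
    have mD: "D \<in> borel_measurable borel" using contD by (rule borel_measurable_continuous_onI)
    have "prod d S = (\<Prod>j\<in>Basis. \<bar>d (h j)\<bar>)"
      unfolding prod.reindex_bij_betw[OF h, of d, symmetric]
      using pos hS by (intro prod.cong refl) (simp add: less_imp_le)
    moreover have "lborel = density (distr lborel borel D) (\<lambda>_. ennreal (\<Prod>j\<in>Basis. \<bar>d (h j)\<bar>))"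
      using lborel_affine_euclidean[of "\<lambda>j. d (h j)" 0] pos hS by (force simp: D_def[abs_def])
    ultimately have "emeasure lborel (D ` X) =
        emeasure (density (distr lborel borel D) (\<lambda>_. ennreal (prod d S))) (D ` X)" by metis
    also have "\<dots> = ennreal (prod d S) * emeasure lborel (D -` D ` X)"
      using mD borel_compact[OF cD] by (simp add: emeasure_density_const emeasure_distr)
    finally show ?thesis by (simp add: Dinv)
  qed
  obtain k where k: "\<And>C. compact C \<Longrightarrow> emeasure lborel (P ` C) = k * emeasure lborel C"
    using emeasure_linear_image_proportional[OF P(1) \<open>inj P\<close>] by blast
  obtain Q where Q: "linear Q" "\<And>x. P (Q x) = x"
    using linear_injective_isomorphism[OF P(1) \<open>inj P\<close>] by blast
  have cQ: "compact (Q ` C)"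
    using Q(1) C by (simp add: compact_continuous_image linear_conv_bounded_linear linear_continuous_on)
  then have cDQ: "compact (D ` Q ` C)" using contD by (simp add: compact_continuous_image)
  have PQ: "P ` Q ` C = C" using Q(2) by (simp add: image_image)
  have "L ` C = P ` D ` Q ` C"
    using comm Q(2) by (metis (no_types, lifting) image_cong image_image)
  then have "emeasure lborel (L ` C) = k * (ennreal (prod d S) * emeasure lborel (Q ` C))"
    using k[OF cDQ] eD[OF cQ] by simp
  also have "\<dots> = ennreal (prod d S) * emeasure lborel C"
    using k[OF cQ] PQ by (simp add: ac_simps)
  finally have "emeasure lborel (L ` C) = ennreal (prod d S) * emeasure lborel C" .
  moreover have "compact (L ` C)"
    using lin C by (simp add: compact_continuous_image linear_conv_bounded_linear linear_continuous_on)
  moreover have "0 \<le> prod d S" using pos by (simp add: prod_nonneg less_imp_le)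
  ultimately show ?thesis
    using C by (simp add: measure_def borel_compact enn2real_mult)
qed

section \<open>Mixed subdivisions\<close>

text \<open>Relative to base points \<open>a\<close> and \<open>b\<close>, the differences
  \<open>X\<close> and \<open>Y\<close> span the space and number \<open>DIM('a)\<close> in total,
  so they form a basis. Up to translation, the cell for \<open>r\<close> is the image of the cell
  for \<open>1\<close> under the map fixing \<open>X\<close> and scaling the
  \<open>card B - 1\<close> vectors of \<open>Y\<close> by \<open>r\<close>.\<close>

lemma measure_outer_cell:
  fixes A B :: "'a::euclidean_space set"
  assumes fin: "finite A" "finite B" and sp: "span (lift A B) = UNIV"
    and card: "card A + card B = DIM('a) + 2" and r: "0 < r"
  shows "measure lebesgue (outer (convex hull A) (convex hull B) r) =
    r ^ (card B - 1) * measure lebesgue (outer (convex hull A) (convex hull B) 1)"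
proof -
  obtain a b where a: "a \<in> A" and b: "b \<in> B" using span_lift_nonempty[OF sp] by blast
  define X where "X = (\<lambda>x. x - a) ` (A - {a})"
  define Y where "Y = (\<lambda>x. x - b) ` (B - {b})"
  have finXY: "finite X" "finite Y" using fin by (auto simp: X_def Y_def)
  have cX: "card X = card A - 1" and cY: "card Y = card B - 1"
    unfolding X_def Y_def using a b fin by (simp_all add: card_image inj_on_def)
  have pos: "0 < card A" "0 < card B" using a b fin card_gt_0_iff by blast+
  have mX: "p - a \<in> span X" if "p \<in> A" for p
    using that by (cases "p = a") (auto simp: X_def span_zero intro: span_base)
  have mY: "q - b \<in> span Y" if "q \<in> B" for q
    using that by (cases "q = b") (auto simp: Y_def span_zero intro: span_base)
  have spXY: "span (X \<union> Y) = UNIV"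
  proof -
    have "x \<in> span (X \<union> Y)" for x
    proof -
      \<comment> \<open>The two zero coordinates make both weight sums vanish, so the base points
        may be subtracted freely.\<close>
      have "(x, 0, 0) \<in> span (lift A B)" using sp by simp
      then obtain l where l: "(x, 0, 0) = (\<Sum>v\<in>lift A B. l v *\<^sub>R v)"
        using span_finite[OF finite_lift[OF fin]] by auto
      let ?u = "\<lambda>p. l (p, 1, 0)" and ?w = "\<lambda>q. l (q, 0, 1)"
      have x: "x = (\<Sum>p\<in>A. ?u p *\<^sub>R p) + (\<Sum>q\<in>B. ?w q *\<^sub>R q)"
        and s: "sum ?u A = 0" "sum ?w B = 0"
        using l unfolding lin_comb_lift[OF fin] by simp_all
      have "(\<Sum>p\<in>A. ?u p *\<^sub>R (p - a)) = (\<Sum>p\<in>A. ?u p *\<^sub>R p)"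
        using s(1) by (simp add: scaleR_diff_right sum_subtractf flip: scaleR_sum_left)
      moreover have "(\<Sum>q\<in>B. ?w q *\<^sub>R (q - b)) = (\<Sum>q\<in>B. ?w q *\<^sub>R q)"
        using s(2) by (simp add: scaleR_diff_right sum_subtractf flip: scaleR_sum_left)
      ultimately have "x = (\<Sum>p\<in>A. ?u p *\<^sub>R (p - a)) + (\<Sum>q\<in>B. ?w q *\<^sub>R (q - b))"
        using x by simp
      also have "\<dots> \<in> span (X \<union> Y)"
        using mX mY span_mono[of X "X \<union> Y"] span_mono[of Y "X \<union> Y"]
        by (intro span_add span_sum span_scale) blast+
      finally show ?thesis .
    qed
    then show ?thesis by blast
  qed
  have "DIM('a) \<le> card (X \<union> Y)"
    using dim_le_card[of "UNIV :: 'a::euclidean_space set" "X \<union> Y"] spXY finXY by simp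
  moreover have un: "card (X \<union> Y) + card (X \<inter> Y) = card X + card Y"
    using card_Un_Int[OF finXY] by simp
  ultimately have cXY: "card (X \<union> Y) = DIM('a)" and "card (X \<inter> Y) = 0"
    using card cX cY pos by linarith+
  then have disj: "X \<inter> Y = {}" using finXY by simp
  have ind: "independent (X \<union> Y)"
    using card_le_dim_spanning[of "X \<union> Y" UNIV] spXY finXY cXY by simp
  define d where "d v = (if v \<in> Y then r else 1)" for v
  obtain L where lin: "linear L" and L: "\<And>v. v \<in> X \<union> Y \<Longrightarrow> L v = d v *\<^sub>R v"
    using linear_independent_extend[OF ind, of "\<lambda>v. d v *\<^sub>R v"] by blast
  have "prod d (X \<union> Y) = prod d X * prod d Y" by (rule prod.union_disjoint[OF finXY disj])
  also have "prod d X = 1" using disj by (intro prod.neutral) (auto simp: d_def)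
  also have "prod d Y = r ^ (card B - 1)" by (simp add: d_def cY)
  finally have prod: "prod d (X \<union> Y) = r ^ (card B - 1)" by simp
  have "L v = v" if "v \<in> X" for v using L[of v] disj that by (auto simp: d_def)
  then have LX: "L v = v" if "v \<in> span X" for v
    using linear_eq_on_span[OF lin linear_ident _ that] by simp
  have "L v = r *\<^sub>R v" if "v \<in> Y" for v using L[of v] that by (auto simp: d_def)
  then have LY: "L v = r *\<^sub>R v" if "v \<in> span Y" for v
    using linear_eq_on_span[OF lin linear_scaleR _ that] by simp
  have conv: "convex {p. p - c \<in> span Z}" for c :: "'a" and Z
  proof -
    have "{p. p - c \<in> span Z} = (+) c ` span Z"
      by (auto simp: image_iff algebra_simps intro!: bexI[of _ "_ - c"])
    then show ?thesis by (simp add: convex_translation subspace_imp_convex)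
  qed
  have hX: "p - a \<in> span X" if "p \<in> convex hull A" for p
    using hull_minimal[of A "{p. p - a \<in> span X}" convex] conv mX that by blast
  have hY: "q - b \<in> span Y" if "q \<in> convex hull B" for q
    using hull_minimal[of B "{q. q - b \<in> span Y}" convex] conv mY that by blast
  define t where "t = a + r *\<^sub>R b - L (a + b)"
  have shift: "p + r *\<^sub>R q = t + L (p + q)" if "p \<in> convex hull A" "q \<in> convex hull B" for p q
  proof -
    have "L (p + q) = L (a + b) + L (p - a) + L (q - b)"
      by (simp add: linear_add[OF lin] linear_diff[OF lin])
    then show ?thesis
      unfolding LX[OF hX[OF that(1)]] LY[OF hY[OF that(2)]] t_def by (simp add: algebra_simps)
  qed
  have "outer (convex hull A) (convex hull B) r
      = (+) t ` L ` outer (convex hull A) (convex hull B) 1" (is "?S r = _ ` _ ` ?S 1")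
  proof (intro subset_antisym subsetI)
    fix x assume "x \<in> ?S r"
    then obtain p q where pq: "p \<in> convex hull A" "q \<in> convex hull B" "x = p + r *\<^sub>R q"
      by (auto elim!: set_plus_elim)
    then have "x = t + L (p + q)" using shift by simp
    moreover have "p + q \<in> ?S 1" using pq by (simp add: set_plus_intro)
    ultimately show "x \<in> (+) t ` L ` ?S 1" by blast
  next
    fix x assume "x \<in> (+) t ` L ` ?S 1"
    then obtain p q where pq: "p \<in> convex hull A" "q \<in> convex hull B" "x = t + L (p + q)"
      by (auto elim!: set_plus_elim)
    then have "x = p + r *\<^sub>R q" using shift by simp
    then show "x \<in> ?S r" using pq by (auto intro!: set_plus_intro)
  qed
  moreover have "compact (?S 1)" using fin by (intro compact_outer finite_imp_compact_convex_hull)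
  then have "measure lebesgue (L ` ?S 1) = r ^ (card B - 1) * measure lebesgue (?S 1)"
    using measure_eigenbasis[OF lin spXY cXY L] r unfolding prod by (simp add: d_def)
  ultimately show ?thesis
    by (simp only: measure_translation)
qed

text \<open>The points of \<open>A\<close> are affinely independent by homogenization. For a cell
  this limits its vertices from the first body, and so forces many from the second when the first
  has low dimension.\<close>

lemma card_independent_lift_le:
  fixes A B :: "'a::euclidean_space set"
  assumes "finite A" "independent (lift A B)" "A \<subseteq> A'"
  shows "int (card A) \<le> aff_dim A' + 1"
proof -
  have "independent (lift A {})"
    by (rule independent_mono[OF assms(2)]) (rule lift_mono, auto)
  then have "\<not> affine_dependent A" using independent_lift_empty_iff[OF assms(1)] by blast
  then have "int (card A) = aff_dim A + 1" using aff_dim_affine_independent by fastforce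
  then show ?thesis using aff_dim_subset[OF assms(3)] by simp
qed

text \<open>An independent spanning set has no proper spanning subset. Distinct cells thus share too
  few vectors to overlap in positive volume.\<close>

lemma dual_basis_inter_span:
  fixes A :: "'w::euclidean_space set"
  assumes indep: "\<And>y. independent {v \<in> A. y \<bullet> v = c v}"
    and B: "dual_basis A c B" and B': "dual_basis A c B'" and ne: "B \<noteq> B'"
  shows "span (B \<inter> B') \<noteq> UNIV"
proof
  assume sp: "span (B \<inter> B') = UNIV"
  have iB: "independent B" "independent B'"
    using B B' indep unfolding dual_basis_def by blast+
  have "B \<subseteq> B'" if "independent B" "span (B \<inter> B') = UNIV" for B B' :: "'w set"
  proof (rule ccontr)
    assume "\<not> B \<subseteq> B'"
    then obtain v where v: "v \<in> B" "v \<notin> B'" by blast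
    then have "span (B \<inter> B') \<subseteq> span (B - {v})" by (intro span_mono) auto
    then show False using that v unfolding dependent_def by blast
  qed
  from this[OF iB(1)] this[OF iB(2)] show False using sp ne by (metis Int_commute subset_antisym)
qed

text \<open>
  The cells \<open>(A', B')\<close> for which \<open>lift A' B'\<close> is a dual basis tile
  \<open>convex hull A + r * convex hull B\<close> for all \<open>r > 0\<close> simultaneously (a mixed subdivision).
\<close>
lemma steiner_polynomial_polytope:
  fixes A B A0 B0 :: "'a::euclidean_space set"
  assumes fin: "finite A" "finite B" and sub: "A0 \<subseteq> A" "B0 \<subseteq> B"
    and ind0: "independent (lift A0 B0)"
  obtains w where "\<And>i. 0 \<le> w i" and "\<And>i. int i < int DIM('a) - aff_dim A \<Longrightarrow> w i = 0"
    and "\<And>r. 0 < r \<Longrightarrow> measure lebesgue (outer (convex hull A) (convex hull B) r)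
          = (\<Sum>i\<le>DIM('a). w i * r ^ i)"
    and "span (lift A0 B0) = UNIV \<Longrightarrow>
          measure lebesgue (outer (convex hull A0) (convex hull B0) 1) \<le> w (card B0 - 1)"
proof -
  let ?n = "DIM('a)"
  obtain c where c0: "\<And>v. v \<in> lift A0 B0 \<Longrightarrow> c v = 0" and cpos: "\<And>v. v \<notin> lift A0 B0 \<Longrightarrow> 0 < c v"
    and indep: "\<And>y. independent {v \<in> lift A B. y \<bullet> v = c v}"
    using generic_cost[OF finite_lift[OF fin] ind0] by blast
  define T where "T = {(A', B'). A' \<subseteq> A \<and> B' \<subseteq> B \<and> dual_basis (lift A B) c (lift A' B')}"
  define S where "S p r = outer (convex hull fst p) (convex hull snd p) r"
    for p :: "'a set \<times> 'a set" and r :: real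
  have finT: "finite T"
    by (rule finite_subset[of _ "Pow A \<times> Pow B"]) (use fin in \<open>auto simp: T_def\<close>)
  have T: "finite (fst p)" "finite (snd p)" "fst p \<subseteq> A" "snd p \<subseteq> B"
    "dual_basis (lift A B) c (lift (fst p) (snd p))" if "p \<in> T" for p
    using that fin finite_subset unfolding T_def by auto
  have spT: "span (lift (fst p) (snd p)) = UNIV" if "p \<in> T" for p
    using T(5)[OF that] unfolding dual_basis_def by blast
  have indT: "independent (lift (fst p) (snd p))" if "p \<in> T" for p
    using T(5)[OF that] indep unfolding dual_basis_def by metis
  have cardT: "card (fst p) + card (snd p) = ?n + 2" if "p \<in> T" for p
  proof -
    have "card (lift (fst p) (snd p)) = dim (UNIV :: (('a) \<times> real \<times> real) set)"
      using dim_eq_card_independent[OF indT[OF that]] dim_span[of "lift (fst p) (snd p)"] spT[OF that] by simp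
    then show ?thesis using card_lift[OF T(1,2)[OF that]] by simp
  qed
  have cardsnd: "1 \<le> card (fst p)" "1 \<le> card (snd p)" if "p \<in> T" for p
    using span_lift_nonempty[OF spT[OF that]] T(1,2)[OF that] by (simp_all add: Suc_leI card_gt_0_iff)
  have measS: "S p r \<in> lmeasurable" if "p \<in> T" for p r
    unfolding S_def using T(1,2)[OF that]
    by (intro lmeasurable_compact compact_outer finite_imp_compact_convex_hull)
  have memS: "x \<in> S p r \<longleftrightarrow> (x, 1, r) \<in> nonneg_span (lift (fst p) (snd p))"
    if "p \<in> T" "0 < r" for p r x
    unfolding S_def using nonneg_span_lift[OF T(1,2)[OF that(1)] that(2)] by blast
  \<comment> \<open>A cell with \<open>i + 1\<close> points from \<open>B\<close> contributes to the
    power \<open>r ^ i\<close>, whence the \<open>Suc\<close>.\<close>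
  define w where "w i = (\<Sum>p\<in>T. if card (snd p) = Suc i then measure lebesgue (S p 1) else 0)" for i
  show thesis
  proof
    show "0 \<le> w i" for i unfolding w_def by (intro sum_nonneg) auto
  next
    fix i assume i: "int i < int ?n - aff_dim A"
    \<comment> \<open>At most \<open>aff_dim A + 1\<close> of the \<open>DIM('a) + 2\<close>
      vertices come from \<open>A\<close>, so at least \<open>DIM('a) + 1 - aff_dim A\<close> come
      from \<open>B\<close>.\<close>
    have "card (snd p) \<noteq> Suc i" if "p \<in> T" for p
      using card_independent_lift_le[OF T(1)[OF that] indT[OF that] T(3)[OF that]] cardT[OF that] i
      by linarith
    then show "w i = 0" unfolding w_def by (intro sum.neutral) auto
  next
    fix r :: real assume r: "0 < r"
    let ?K = "outer (convex hull A) (convex hull B) r"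
    \<comment> \<open>The exceptional null set \<open>N\<close> collects the sections of all proper
      spans. Off \<open>N\<close> the point \<open>(x, 1, r)\<close> is generic in the sense of
      \<open>exists_dual_basis\<close>, and cell overlaps lie inside \<open>N\<close>.\<close>
    define NS where "NS = {C. C \<subseteq> lift A B \<and> span C \<noteq> UNIV}"
    define N where "N = (\<Union>C\<in>NS. {x. (x, 1, r) \<in> span C})"
    have "NS \<subseteq> Pow (lift A B)" unfolding NS_def by blast
    then have finNS: "finite NS" using finite_lift[OF fin] by (meson finite_Pow_iff finite_subset)
    have negN: "negligible {x. (x, 1, r) \<in> span C}" if C: "C \<subseteq> lift A B" "span C \<noteq> UNIV" for C
    proof -
      obtain A' B' where "C = lift A' B'" using subset_lift_eq[OF C(1)] by blast
      then show ?thesis using C(2) negligible_span_lift_section[OF _ r] by blast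
    qed
    have neg: "negligible N"
      unfolding N_def
    proof (rule negligible_Union)
      show "finite ((\<lambda>C. {x. (x, 1, r) \<in> span C}) ` NS)" using finNS by (rule finite_imageI)
      fix X assume "X \<in> (\<lambda>C. {x. (x, 1, r) \<in> span C}) ` NS"
      then obtain C where "C \<in> NS" "X = {x. (x, 1, r) \<in> span C}" by blast
      then show "negligible X" using negN unfolding NS_def by blast
    qed
    have "(\<Union>p\<in>T. S p r) \<subseteq> ?K"
      unfolding S_def using T(3,4) by (intro UN_least outer_mono hull_mono)
    moreover have "?K - (\<Union>p\<in>T. S p r) \<subseteq> N"
    proof
      fix x assume x: "x \<in> ?K - (\<Union>p\<in>T. S p r)"
      show "x \<in> N"
      proof (rule ccontr)
        assume nN: "x \<notin> N"
        have "(x, 1, r) \<in> nonneg_span (lift A B)"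
          using x nonneg_span_lift[OF fin r] by blast
        moreover have "0 \<le> c v" for v using c0[of v] cpos[of v] by (cases "v \<in> lift A0 B0") simp_all
        moreover have "(x, 1, r) \<notin> span C" if "C \<subseteq> lift A B" "span C \<noteq> UNIV" for C
          using nN that unfolding N_def NS_def by blast
        ultimately obtain C where C: "dual_basis (lift A B) c C" "(x, 1, r) \<in> nonneg_span C"
          using exists_dual_basis[OF finite_lift[OF fin] _ indep] by metis
        then have "C \<subseteq> lift A B" unfolding dual_basis_def by blast
        then obtain A' B' where "A' \<subseteq> A" "B' \<subseteq> B" "C = lift A' B'" by (rule subset_lift_eq)
        then have "(A', B') \<in> T" "x \<in> S (A', B') r"
          using C memS[of "(A', B')" r x] r by (auto simp: T_def)
        then show False using x by blast
      qed
    qed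
    ultimately have "negligible ((\<Union>p\<in>T. S p r) - ?K \<union> (?K - (\<Union>p\<in>T. S p r)))"
      using negligible_subset[OF neg] by (metis Diff_eq_empty_iff sup_bot_left)
    moreover have "(\<Union>p\<in>T. S p r) \<in> lmeasurable"
      using finT measS by (intro fmeasurable.finite_UN) auto
    ultimately have "measure lebesgue ?K = measure lebesgue (\<Union>p\<in>T. S p r)"
      by (intro measure_negligible_symdiff)
    also have "\<dots> = (\<Sum>p\<in>T. measure lebesgue (S p r))"
    proof (rule measure_negligible_finite_Union_image[OF finT measS])
      show "pairwise (\<lambda>p q. negligible (S p r \<inter> S q r)) T"
      proof (rule pairwiseI)
        fix p q assume pq: "p \<in> T" "q \<in> T" "p \<noteq> q"
        let ?C = "lift (fst p) (snd p) \<inter> lift (fst q) (snd q)"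
        have "lift (fst p) (snd p) \<noteq> lift (fst q) (snd q)"
          using pq by (simp add: lift_inject prod_eq_iff)
        then have "span ?C \<noteq> UNIV"
          using dual_basis_inter_span[OF indep T(5)[OF pq(1)] T(5)[OF pq(2)]] by blast
        moreover have "?C \<subseteq> lift A B"
          using lift_mono[OF T(3,4)[OF pq(1)]] by blast
        ultimately have "negligible {x. (x, 1, r) \<in> span ?C}" by (intro negN)
        moreover have "S p r \<inter> S q r \<subseteq> {x. (x, 1, r) \<in> span ?C}"
          using memS[OF pq(1) r] memS[OF pq(2) r]
            dual_basis_nonneg_span_inter[OF finite_lift[OF fin] T(5)[OF pq(1)] T(5)[OF pq(2)]] by blast
        ultimately show "negligible (S p r \<inter> S q r)" by (rule negligible_subset)
      qed
    qed
    also have "\<dots> = (\<Sum>p\<in>T. \<Sum>i\<le>?n. if card (snd p) = Suc i then measure lebesgue (S p 1) * r ^ i else 0)"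
    proof (rule sum.cong[OF refl])
      fix p assume p: "p \<in> T"
      have le: "card (snd p) - 1 \<le> ?n" using cardT[OF p] cardsnd[OF p] by linarith
      have "(\<Sum>i\<le>?n. if card (snd p) = Suc i then measure lebesgue (S p 1) * r ^ i else 0)
          = (\<Sum>i\<le>?n. if i = card (snd p) - 1 then measure lebesgue (S p 1) * r ^ i else 0)"
        using cardsnd[OF p] by (intro sum.cong) auto
      also have "\<dots> = measure lebesgue (S p 1) * r ^ (card (snd p) - 1)"
        using le by simp
      also have "\<dots> = measure lebesgue (S p r)"
        using measure_outer_cell[OF T(1,2)[OF p] spT[OF p] cardT[OF p] r] by (simp add: S_def)
      finally show "measure lebesgue (S p r) =
          (\<Sum>i\<le>?n. if card (snd p) = Suc i then measure lebesgue (S p 1) * r ^ i else 0)"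
        by (rule sym)
    qed
    also have "\<dots> = (\<Sum>i\<le>?n. \<Sum>p\<in>T. if card (snd p) = Suc i then measure lebesgue (S p 1) * r ^ i else 0)"
      by (rule sum.swap)
    also have "\<dots> = (\<Sum>i\<le>?n. w i * r ^ i)"
      unfolding w_def sum_distrib_right by (intro sum.cong refl) simp
    finally show "measure lebesgue ?K = (\<Sum>i\<le>?n. w i * r ^ i)" .
  next
    assume sp0: "span (lift A0 B0) = UNIV"
    \<comment> \<open>The dual solution \<open>y = 0\<close> is tight exactly at the vectors of cost
      zero, so the prescribed cell occurs in the tiling.\<close>
    have "lift A0 B0 = {v \<in> lift A B. 0 \<bullet> v = c v}"
      using c0 cpos lift_mono[OF sub] by force
    moreover have "\<forall>v\<in>lift A B. 0 \<bullet> v \<le> c v"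
      using c0 cpos by (metis inner_zero_left less_eq_real_def)
    ultimately have "dual_basis (lift A B) c (lift A0 B0)"
      unfolding dual_basis_def using sp0 by blast
    then have p: "(A0, B0) \<in> T" using sub by (simp add: T_def)
    have "measure lebesgue (S (A0, B0) 1) =
        (if card (snd (A0, B0)) = Suc (card B0 - 1) then measure lebesgue (S (A0, B0) 1) else 0)"
      using cardsnd(2)[OF p] by simp
    also have "\<dots> \<le> w (card B0 - 1)"
      unfolding w_def using p finT by (intro member_le_sum) auto
    finally show "measure lebesgue (outer (convex hull A0) (convex hull B0) 1) \<le> w (card B0 - 1)"
      by (simp add: S_def)
  qed
qed

section \<open>The Steiner polynomial\<close>

lemma polynomial_coeffs_unique:
  fixes a b :: "nat \<Rightarrow> real"
  assumes "\<And>r. 0 < r \<Longrightarrow> (\<Sum>i\<le>n. a i * r ^ i) = (\<Sum>i\<le>n. b i * r ^ i)" and "i \<le> n"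
  shows "a i = b i"
proof (rule ccontr)
  assume "a i \<noteq> b i"
  then have "finite {z::real. (\<Sum>i\<le>n. (a i - b i) * z ^ i) = 0}"
    using assms(2) by (subst polyfun_finite_roots) auto
  moreover have "{0<..} \<subseteq> {z::real. (\<Sum>i\<le>n. (a i - b i) * z ^ i) = 0}"
    using assms(1) by (auto simp: left_diff_distrib sum_subtractf)
  ultimately show False using infinite_Ioi finite_subset by blast
qed

text \<open>Bolzano-Weierstrass, passing to a further subsequence for one index at a time.\<close>

lemma convergent_subsequence_finite:
  fixes w :: "nat \<Rightarrow> nat \<Rightarrow> real"
  assumes "\<And>k i. i \<le> n \<Longrightarrow> \<bar>w k i\<bar> \<le> b"
  obtains \<phi> l where "strict_mono \<phi>" "\<And>i. i \<le> n \<Longrightarrow> (\<lambda>k. w (\<phi> k) i) \<longlonglongrightarrow> l i"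
proof -
  have bdd: "bounded (range (\<lambda>k. w (\<phi> k) i))" if "i \<le> n" for i and \<phi> :: "nat \<Rightarrow> nat"
    using assms[OF that] by (auto simp: bounded_iff)
  have "\<exists>\<phi> l. strict_mono \<phi> \<and> (\<forall>i<m. (\<lambda>k. w (\<phi> k) i) \<longlonglongrightarrow> l i)" if "m \<le> Suc n" for m
    using that
  proof (induction m)
    case 0
    then show ?case by (auto intro: strict_mono_id)
  next
    case (Suc m)
    then obtain \<phi> l where \<phi>: "strict_mono \<phi>" "\<And>i. i < m \<Longrightarrow> (\<lambda>k. w (\<phi> k) i) \<longlonglongrightarrow> l i"
      by auto
    obtain x \<psi> where \<psi>: "strict_mono \<psi>" "((\<lambda>k. w (\<phi> k) m) \<circ> \<psi>) \<longlonglongrightarrow> x"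
      using bounded_imp_convergent_subsequence[OF bdd[of m \<phi>]] Suc.prems by auto
    have "strict_mono (\<phi> \<circ> \<psi>)" using \<phi>(1) \<psi>(1) by (rule strict_mono_o)
    moreover have "(\<lambda>k. w ((\<phi> \<circ> \<psi>) k) i) \<longlonglongrightarrow> (l(m := x)) i" if "i < Suc m" for i
    proof (cases "i = m")
      case True
      then show ?thesis using \<psi>(2) by (simp add: o_def)
    next
      case False
      then show ?thesis
        using that LIMSEQ_subseq_LIMSEQ[OF \<phi>(2) \<psi>(1), of i] by (simp add: o_def)
    qed
    ultimately show ?case by blast
  qed
  from this[of "Suc n"] that show thesis by (auto simp: less_Suc_eq_le)
qed

section \<open>Approximation by increasing sequences of polytopes\<close>

lemma finite_sets_exhausting:
  fixes K :: "'a::euclidean_space set"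
  assumes "finite F" "F \<subseteq> K" "K \<noteq> {}"
  obtains A where "\<And>k. finite (A k)" "\<And>k. F \<subseteq> A k" "\<And>k. A k \<subseteq> K" "incseq A" "K \<subseteq> closure (\<Union>k. A k)"
proof -
  obtain T where T: "countable T" "T \<subseteq> K" "K \<subseteq> closure T" using separable by blast
  then have "T \<noteq> {}" using assms(3) by auto
  then have rng: "range (from_nat_into T) = T" using T(1) by (rule range_from_nat_into)
  \<comment> \<open>Initial segments of a countable dense subset; \<open>F\<close> is present at
    every stage so that a prescribed cell is never lost.\<close>
  define A where "A k = F \<union> from_nat_into T ` {..k}" for k :: nat
  show thesis
  proof
    show "incseq A" unfolding A_def incseq_def by (auto intro!: image_eqI)
    have "T \<subseteq> (\<Union>k. A k)" using rng unfolding A_def by blast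
    then show "K \<subseteq> closure (\<Union>k. A k)" using T(3) closure_mono by blast
    show "A k \<subseteq> K" for k using assms(2) T(2) from_nat_into[OF \<open>T \<noteq> {}\<close>] unfolding A_def by blast
  qed (use assms(1) in \<open>auto simp: A_def\<close>)
qed

text \<open>The union \<open>U\<close> of the increasing polytopes is convex and dense in the body,
  so the body exceeds \<open>U\<close> only within the null frontier of \<open>U\<close>. Continuity
  from below does the rest.\<close>

lemma measure_outer_exhausting_limit:
  fixes M E :: "'a::euclidean_space set"
  assumes M: "compact M" "convex M" and E: "compact E" "convex E"
    and A: "\<And>k. finite (A k)" "\<And>k. A k \<subseteq> M" "incseq A" "M \<subseteq> closure (\<Union>k. A k)"
    and B: "\<And>k. finite (B k)" "\<And>k. B k \<subseteq> E" "incseq B" "E \<subseteq> closure (\<Union>k. B k)"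
  shows "(\<lambda>k. measure lebesgue (outer (convex hull A k) (convex hull B k) r))
    \<longlonglongrightarrow> measure lebesgue (outer M E r)"
proof -
  define S where "S k = outer (convex hull A k) (convex hull B k) r" for k
  define U where "U = (\<Union>k. S k)"
  have cM: "compact (outer M E r)" using M E by (intro compact_outer)
  have inc: "incseq S"
    unfolding S_def using incseqD[OF A(3)] incseqD[OF B(3)]
    by (intro incseq_def[THEN iffD2] allI impI outer_mono hull_mono)
  have cS: "compact (S k)" for k
    unfolding S_def using A(1) B(1) by (intro compact_outer finite_imp_compact_convex_hull)
  have vS: "convex (S k)" for k unfolding S_def by (rule convex_outer[OF convex_convex_hull convex_convex_hull])
  have "S k \<subseteq> outer M E r" for k
    unfolding S_def using A(2) B(2) M E by (intro outer_mono hull_minimal)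
  then have UK: "U \<subseteq> outer M E r" unfolding U_def by blast
  have "convex U"
  proof (rule convexI)
    fix x y :: 'a and u v :: real
    assume "x \<in> U" "y \<in> U" and uv: "0 \<le> u" "0 \<le> v" "u + v = 1"
    then obtain k l where kl: "x \<in> S k" "y \<in> S l" unfolding U_def by blast
    have "S k \<subseteq> S (max k l)" "S l \<subseteq> S (max k l)" using inc by (auto simp: incseq_def)
    then have "u *\<^sub>R x + v *\<^sub>R y \<in> S (max k l)" using kl vS uv by (intro convexD) auto
    then show "u *\<^sub>R x + v *\<^sub>R y \<in> U" unfolding U_def by blast
  qed
  have "outer (\<Union>k. A k) (\<Union>k. B k) r \<subseteq> U"
  proof
    fix x assume "x \<in> outer (\<Union>k. A k) (\<Union>k. B k) r"
    then obtain p q k l where pq: "p \<in> A k" "q \<in> B l" "x = p + r *\<^sub>R q"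
      by (auto elim!: set_plus_elim)
    have "A k \<subseteq> A (max k l)" "B l \<subseteq> B (max k l)" using A(3) B(3) by (auto simp: incseq_def)
    then have "p \<in> convex hull A (max k l)" "q \<in> convex hull B (max k l)"
      using pq by (auto intro: hull_inc)
    then have "x \<in> S (max k l)" unfolding S_def pq(3) by (intro set_plus_intro imageI)
    then show "x \<in> U" unfolding U_def by blast
  qed
  then have "closure (outer (\<Union>k. A k) (\<Union>k. B k) r) \<subseteq> closure U" by (rule closure_mono)
  moreover have "outer M E r \<subseteq> closure (\<Union>k. A k) + (\<lambda>x. r *\<^sub>R x) ` closure (\<Union>k. B k)"
    using A(4) B(4) by (rule outer_mono)
  moreover have "\<dots> \<subseteq> closure (outer (\<Union>k. A k) (\<Union>k. B k) r)"
    unfolding closure_scaleR by (rule closure_sum)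
  ultimately have KU: "outer M E r \<subseteq> closure U" by blast
  have "outer M E r - U \<subseteq> frontier U"
    using KU interior_subset unfolding frontier_def by blast
  then have "negligible (outer M E r - U \<union> (U - outer M E r))"
    using UK negligible_convex_frontier[OF \<open>convex U\<close>] by (simp add: negligible_subset Diff_eq_empty_iff[THEN iffD2])
  then have "measure lebesgue U = measure lebesgue (outer M E r)"
    using cM by (intro measure_negligible_symdiff lmeasurable_compact)
  moreover have "(\<lambda>k. measure lebesgue (S k)) \<longlonglongrightarrow> measure lebesgue U"
    unfolding U_def
  proof (rule Lim_measure_incseq[OF _ inc])
    show "range S \<subseteq> sets lebesgue" using cS lmeasurable_compact fmeasurableD by blast
    have "U \<in> lmeasurable"
      using \<open>convex U\<close> bounded_subset[OF compact_imp_bounded[OF cM] UK] by (rule measurable_convex)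
    then show "emeasure lebesgue (\<Union>k. S k) \<noteq> \<infinity>"
      unfolding U_def[symmetric] using fmeasurableD2 by fastforce
  qed
  ultimately show ?thesis unfolding S_def by simp
qed

text \<open>The lifts of \<open>DIM('a) - j + 1\<close> affinely independent points of
  \<open>M\<close> are independent. Extended to a basis of the space of dimension
  \<open>DIM('a) + 2\<close>, they leave room for exactly \<open>j + 1\<close> points of
  \<open>E\<close>.\<close>

lemma exists_full_cell:
  fixes M E :: "'a::euclidean_space set"
  assumes E: "aff_dim E = DIM('a)" and j: "j \<le> DIM('a)" and M: "int (DIM('a) - j) \<le> aff_dim M"
  obtains A B where "finite A" "finite B" "A \<subseteq> M" "B \<subseteq> E" "card B = Suc j"
    "independent (lift A B)" "span (lift A B) = UNIV"
proof -
  obtain A' where A': "\<not> affine_dependent A'" "A' \<subseteq> M" "affine hull A' = affine hull M"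
    using affine_basis_exists[of M] by metis
  have "int (card A') = aff_dim M + 1"
    using aff_dim_unique[of A' M] A'(1,3) by blast
  then have "Suc (DIM('a) - j) \<le> card A'" using M by linarith
  then obtain A where A: "A \<subseteq> A'" "card A = Suc (DIM('a) - j)" "finite A"
    using obtain_subset_with_card_n by metis
  have iA: "independent (lift A {})"
    using A A'(1) affine_independent_subset independent_lift_empty_iff by blast
  have neA: "A \<noteq> {}" using A(2) by auto
  \<comment> \<open>Extending inside \<open>lift A E\<close> rather than \<open>lift M E\<close>
    admits no further points of \<open>M\<close>, which keeps the count exact.\<close>
  have "lift A {} \<subseteq> lift A E" by (rule lift_mono) auto
  then obtain C where C: "lift A {} \<subseteq> C" "C \<subseteq> lift A E" "independent C" "lift A E \<subseteq> span C"
    using maximal_independent_subset_extend[OF _ iA] by metis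
  obtain A'' B where B: "A'' \<subseteq> A" "B \<subseteq> E" "C = lift A'' B" using subset_lift_eq[OF C(2)] by blast
  have "A \<subseteq> A''"
  proof
    fix a assume "a \<in> A"
    then have "(a, 1, 0) \<in> C" using C(1) by (auto simp: lift_def)
    then show "a \<in> A''" unfolding B(3) by simp
  qed
  then have CAB: "C = lift A B" using B by simp
  have spC: "span C = UNIV"
    using span_minimal[OF C(4) subspace_span] span_lift_eq_UNIV[OF neA E] by blast
  have "finite C" using C(3) by (rule finiteI_independent)
  then have "finite ((\<lambda>b. (b, 0 :: real, 1 :: real)) ` B)"
    unfolding CAB lift_def by simp
  then have finB: "finite B" by (rule finite_imageD) (simp add: inj_on_def)
  have "card C = dim (UNIV :: ('a \<times> real \<times> real) set)"
    using dim_eq_card_independent[OF C(3)] dim_span[of C] spC by simp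
  then have "card B = Suc j" using card_lift[OF A(3) finB] A(2) j by (simp add: CAB)
  then show thesis
    using that[of A B] A A'(2) B(2) finB C(3) spC CAB by blast
qed

text \<open>All approximating polytopes contain one full cell with \<open>j + 1\<close> points from
  \<open>E\<close>, whose volume bounds their coefficients of index \<open>j\<close> from below
  uniformly. Signs, vanishing and this bound pass to a subsequential limit.\<close>

lemma steiner_polynomial_pos_coeff:
  fixes M E :: "'a::euclidean_space set"
  assumes M: "convex_body M" and E: "convex_body E" "aff_dim E = DIM('a)"
    and j: "j \<le> DIM('a)" "int (DIM('a) - j) \<le> aff_dim M"
  obtains w where "\<And>i. i \<le> DIM('a) \<Longrightarrow> 0 \<le> w i"
    and "\<And>i. i \<le> DIM('a) \<Longrightarrow> int i < int DIM('a) - aff_dim M \<Longrightarrow> w i = 0"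
    and "\<And>r. 0 < r \<Longrightarrow> measure lebesgue (outer M E r) = (\<Sum>i\<le>DIM('a). w i * r ^ i)"
    and "0 < w j"
proof -
  have M': "M \<noteq> {}" "compact M" "convex M" and E': "E \<noteq> {}" "compact E" "convex E"
    using M E by (auto simp: convex_body_def)
  obtain A0 B0 where AB0: "finite A0" "finite B0" "A0 \<subseteq> M" "B0 \<subseteq> E" "card B0 = Suc j"
    "independent (lift A0 B0)" "span (lift A0 B0) = UNIV"
    using exists_full_cell[OF E(2) j] by blast
  obtain A where A: "\<And>k. finite (A k)" "\<And>k. A0 \<subseteq> A k" "\<And>k. A k \<subseteq> M" "incseq A" "M \<subseteq> closure (\<Union>k. A k)"
    using finite_sets_exhausting[OF AB0(1,3) M'(1)] by blast
  obtain B where B: "\<And>k. finite (B k)" "\<And>k. B0 \<subseteq> B k" "\<And>k. B k \<subseteq> E" "incseq B" "E \<subseteq> closure (\<Union>k. B k)"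
    using finite_sets_exhausting[OF AB0(2,4) E'(1)] by blast
  define S where "S k r = outer (convex hull A k) (convex hull B k) r" for k r
  define \<delta> where "\<delta> = measure lebesgue (outer (convex hull A0) (convex hull B0) 1)"
  have \<delta>: "0 < \<delta>" unfolding \<delta>_def by (rule measure_outer_cell_pos[OF AB0(1,2,7)])
  have "\<forall>k. \<exists>w. (\<forall>i. 0 \<le> w i) \<and> (\<forall>i. int i < int DIM('a) - aff_dim (A k) \<longrightarrow> w i = 0)
      \<and> (\<forall>r>0. measure lebesgue (S k r) = (\<Sum>i\<le>DIM('a). w i * r ^ i)) \<and> \<delta> \<le> w j"
  proof
    fix k
    obtain w where "\<And>i. 0 \<le> w i" "\<And>i. int i < int DIM('a) - aff_dim (A k) \<Longrightarrow> w i = 0"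
      "\<And>r. 0 < r \<Longrightarrow> measure lebesgue (S k r) = (\<Sum>i\<le>DIM('a). w i * r ^ i)"
      "span (lift A0 B0) = UNIV \<Longrightarrow> \<delta> \<le> w (card B0 - 1)"
      unfolding S_def \<delta>_def
      using steiner_polynomial_polytope[OF A(1) B(1) A(2) B(2) AB0(6)] by blast
    then show "\<exists>w. (\<forall>i. 0 \<le> w i) \<and> (\<forall>i. int i < int DIM('a) - aff_dim (A k) \<longrightarrow> w i = 0)
      \<and> (\<forall>r>0. measure lebesgue (S k r) = (\<Sum>i\<le>DIM('a). w i * r ^ i)) \<and> \<delta> \<le> w j"
      using AB0(5,7) by (intro exI[of _ w]) simp
  qed
  from choice[OF this] obtain w where w: "\<And>k i. 0 \<le> w k i"
    "\<And>k i. int i < int DIM('a) - aff_dim (A k) \<Longrightarrow> w k i = 0"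
    "\<And>k r. 0 < r \<Longrightarrow> measure lebesgue (S k r) = (\<Sum>i\<le>DIM('a). w k i * r ^ i)"
    "\<And>k. \<delta> \<le> w k j" by blast
  \<comment> \<open>The coefficients are nonnegative and sum to the value of the polynomial at
    \<open>r = 1\<close>.\<close>
  have "\<bar>w k i\<bar> \<le> measure lebesgue (outer M E 1)" if "i \<le> DIM('a)" for k i
  proof -
    have "w k i \<le> (\<Sum>i\<le>DIM('a). w k i)" using that w(1) by (intro member_le_sum) auto
    also have "\<dots> = measure lebesgue (S k 1)" using w(3)[of 1 k] by simp
    also have "\<dots> \<le> measure lebesgue (outer M E 1)"
    proof (rule measure_mono_fmeasurable)
      show "S k 1 \<subseteq> outer M E 1"
        unfolding S_def using A(3) B(3) M'(3) E'(3) by (intro outer_mono hull_minimal)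
      have "compact (S k 1)"
        unfolding S_def using A(1) B(1) by (intro compact_outer finite_imp_compact_convex_hull)
      then show "S k 1 \<in> sets lebesgue" using lmeasurable_compact fmeasurableD by blast
      show "outer M E 1 \<in> lmeasurable" using M'(2) E'(2) by (intro lmeasurable_compact compact_outer)
    qed
    finally show ?thesis using w(1) by simp
  qed
  then obtain \<phi> l where \<phi>: "strict_mono \<phi>" and l: "\<And>i. i \<le> DIM('a) \<Longrightarrow> (\<lambda>k. w (\<phi> k) i) \<longlonglongrightarrow> l i"
    using convergent_subsequence_finite[of "DIM('a)" w] by blast
  show thesis
  proof
    show "0 \<le> l i" if "i \<le> DIM('a)" for i
      using l[OF that] w(1) by (intro LIMSEQ_le_const) auto
    show "l i = 0" if i: "i \<le> DIM('a)" "int i < int DIM('a) - aff_dim M" for i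
    proof -
      have "w k i = 0" for k using i(2) aff_dim_subset[OF A(3)[of k]] by (intro w(2)) linarith
      then show ?thesis using l[OF i(1)] by (simp add: LIMSEQ_const_iff)
    qed
    show "measure lebesgue (outer M E r) = (\<Sum>i\<le>DIM('a). l i * r ^ i)" if "0 < r" for r
    proof (rule LIMSEQ_unique)
      show "(\<lambda>k. measure lebesgue (S (\<phi> k) r)) \<longlonglongrightarrow> (\<Sum>i\<le>DIM('a). l i * r ^ i)"
        unfolding w(3)[OF that] using l by (intro tendsto_sum tendsto_mult_right) auto
      have "(\<lambda>k. measure lebesgue (S k r)) \<longlonglongrightarrow> measure lebesgue (outer M E r)"
        unfolding S_def using measure_outer_exhausting_limit[OF M'(2,3) E'(2,3) A(1,3,4,5) B(1,3,4,5)] .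
      from LIMSEQ_subseq_LIMSEQ[OF this \<phi>]
      show "(\<lambda>k. measure lebesgue (S (\<phi> k) r)) \<longlonglongrightarrow> measure lebesgue (outer M E r)"
        by (simp add: o_def)
    qed
    have "\<delta> \<le> l j" using l[OF j(1)] w(4) by (intro LIMSEQ_le_const) auto
    then show "0 < l j" using \<delta> by linarith
  qed
qed

text \<open>The coefficients obtained for different \<open>j\<close> belong to the same polynomial,
  so a single family has all the positivity properties at once. Dividing by binomial coefficients
  gives the normalization of the relative Steiner formula.\<close>

theorem steiner_polynomial:
  fixes M E :: "'a::euclidean_space set"
  assumes M: "convex_body M" and E: "convex_body E" "aff_dim E = DIM('a)"
  obtains w where "\<And>i. i \<le> DIM('a) \<Longrightarrow> 0 \<le> w i"
    and "\<And>i. i \<le> DIM('a) \<Longrightarrow> w i = 0 \<longleftrightarrow> aff_dim M \<le> int DIM('a) - int i - 1"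
    and "\<And>r. 0 < r \<Longrightarrow> measure lebesgue (outer M E r)
          = (\<Sum>i\<le>DIM('a). real (DIM('a) choose i) * (w i * r ^ i))"
proof -
  let ?n = "DIM('a)"
  \<comment> \<open>The index \<open>j = DIM('a)\<close> is admissible for every nonempty
    \<open>M\<close> and supplies a first family \<open>u\<close>.\<close>
  have "0 \<le> aff_dim M" using M aff_dim_negative_iff[of M] by (simp add: convex_body_def not_less[symmetric])
  then have le: "int (?n - ?n) \<le> aff_dim M" by simp
  obtain u where u: "\<And>i. i \<le> ?n \<Longrightarrow> 0 \<le> u i"
    "\<And>i. i \<le> ?n \<Longrightarrow> int i < int ?n - aff_dim M \<Longrightarrow> u i = 0"
    "\<And>r. 0 < r \<Longrightarrow> measure lebesgue (outer M E r) = (\<Sum>i\<le>?n. u i * r ^ i)"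
    by (rule steiner_polynomial_pos_coeff[OF M E order_refl le]) (rule that)
  have pos: "0 < u j" if j: "j \<le> ?n" "\<not> aff_dim M \<le> int ?n - int j - 1" for j
  proof -
    have "int (?n - j) \<le> aff_dim M" using j by linarith
    then obtain v where v: "\<And>r. 0 < r \<Longrightarrow> measure lebesgue (outer M E r) = (\<Sum>i\<le>?n. v i * r ^ i)" "0 < v j"
      by (rule steiner_polynomial_pos_coeff[OF M E j(1)]) (rule that)
    have "u j = v j"
    proof (rule polynomial_coeffs_unique[OF _ j(1)])
      fix r :: real assume "0 < r"
      from u(3)[OF this] v(1)[OF this] show "(\<Sum>i\<le>?n. u i * r ^ i) = (\<Sum>i\<le>?n. v i * r ^ i)" by simp
    qed
    then show ?thesis using v(2) by simp
  qed
  define w where "w i = u i / real (?n choose i)" for i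
  have ch: "0 < real (?n choose i)" if "i \<le> ?n" for i using that by simp
  show thesis
  proof
    show "0 \<le> w i" if "i \<le> ?n" for i using u(1)[OF that] by (simp add: w_def)
    show "w i = 0 \<longleftrightarrow> aff_dim M \<le> int ?n - int i - 1" if i: "i \<le> ?n" for i
    proof
      assume "w i = 0"
      then show "aff_dim M \<le> int ?n - int i - 1" using pos[OF i] ch[OF i] by (force simp: w_def)
    next
      assume "aff_dim M \<le> int ?n - int i - 1"
      then show "w i = 0" using u(2)[OF i] by (simp add: w_def)
    qed
    fix r :: real assume "0 < r"
    have "(\<Sum>i\<le>?n. u i * r ^ i) = (\<Sum>i\<le>?n. real (?n choose i) * (w i * r ^ i))"
      using ch by (intro sum.cong refl) (simp add: w_def)
    then show "measure lebesgue (outer M E r) = (\<Sum>i\<le>?n. real (?n choose i) * (w i * r ^ i))"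
      using u(3)[OF \<open>0 < r\<close>] by simp
  qed
qed

section \<open>Alternating sums of quermassintegrals\<close>

lemma binomial_sum_Suc:
  fixes h :: "nat \<Rightarrow> real"
  shows "(\<Sum>k\<le>Suc d. real (Suc d choose k) * h k)
    = (\<Sum>k\<le>d. real (d choose k) * h k) + (\<Sum>k\<le>d. real (d choose k) * h (Suc k))"
proof -
  have "(\<Sum>k\<le>d. real (d choose k) * h k) = (\<Sum>k\<le>Suc d. real (d choose k) * h k)"
    by (simp add: binomial_eq_0)
  also have "\<dots> = h 0 + (\<Sum>k\<le>d. real (d choose Suc k) * h (Suc k))"
    by (subst sum.atMost_Suc_shift) simp
  finally show ?thesis
    by (subst sum.atMost_Suc_shift) (simp add: sum.distrib algebra_simps)
qed

text \<open>With S the shift of sequences, this is (1 + S)^a applied to \<open>w\<close> and read at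
  \<open>m\<close>. If \<open>w\<close> lists the quermassintegrals of \<open>M\<close> relative to
  \<open>E\<close> and \<open>a + m \<le> n\<close>, it is the mixed volume with
  \<open>M + E\<close> taken \<open>a\<close> times, \<open>E\<close> taken \<open>m\<close> times
  and \<open>M\<close> for the rest.\<close>

definition binomial_transform :: "(nat \<Rightarrow> real) \<Rightarrow> nat \<Rightarrow> nat \<Rightarrow> real" where
  "binomial_transform w a m = (\<Sum>l\<le>a. real (a choose l) * w (m + l))"

lemma binomial_transform_Suc:
  "binomial_transform w (Suc a) m = binomial_transform w a m + binomial_transform w a (Suc m)"
  unfolding binomial_transform_def using binomial_sum_Suc[of a "\<lambda>l. w (m + l)"] by simp

text \<open>In terms of the shift S this expands ((1 + S) - S)^d = 1, applied to (1 + S)^a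
  \<open>w\<close>.\<close>

lemma alternating_binomial_transform:
  "(\<Sum>k\<le>d. real (d choose k) * ((- 1) ^ k * binomial_transform w (a + d - k) (m + k)))
    = binomial_transform w a m"
proof (induction d arbitrary: a m)
  case 0
  then show ?case by simp
next
  case (Suc d)
  have "(\<Sum>k\<le>Suc d. real (Suc d choose k) * ((- 1) ^ k * binomial_transform w (a + Suc d - k) (m + k)))
      = (\<Sum>k\<le>d. real (d choose k) * ((- 1) ^ k * binomial_transform w (Suc a + d - k) (m + k)))
        - (\<Sum>k\<le>d. real (d choose k) * ((- 1) ^ k * binomial_transform w (a + d - k) (Suc m + k)))"
    by (subst binomial_sum_Suc) (simp add: sum_negf)
  then show ?case unfolding Suc.IH by (simp add: binomial_transform_Suc)
qed

text \<open>In terms of the shift S, both sides expand ((1 + S) + r S)^n = (1 + (1 + r) S)^n. The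
  offset \<open>c\<close> is kept free for the induction.\<close>

lemma binomial_transform_shift:
  "(\<Sum>m\<le>n. real (n choose m) * (binomial_transform w (n - m) (c + m) * r ^ m))
    = (\<Sum>p\<le>n. real (n choose p) * (w (c + p) * (1 + r) ^ p))"
proof (induction n arbitrary: c)
  case 0
  then show ?case by (simp add: binomial_transform_def)
next
  case (Suc n)
  let ?L = "\<lambda>c. \<Sum>m\<le>n. real (n choose m) * (binomial_transform w (n - m) (c + m) * r ^ m)"
  let ?R = "\<lambda>c. \<Sum>p\<le>n. real (n choose p) * (w (c + p) * (1 + r) ^ p)"
  have "(\<Sum>m\<le>n. real (n choose m) * (binomial_transform w (Suc n - m) (c + m) * r ^ m)) = ?L c + ?L (Suc c)"
    unfolding sum.distrib[symmetric]
    by (intro sum.cong refl) (simp add: Suc_diff_le binomial_transform_Suc algebra_simps)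
  moreover have "(\<Sum>m\<le>n. real (n choose m) * (binomial_transform w (Suc n - Suc m) (c + Suc m) * r ^ Suc m))
      = r * ?L (Suc c)"
    unfolding sum_distrib_left by (intro sum.cong refl) (simp add: algebra_simps)
  moreover have "(\<Sum>p\<le>n. real (n choose p) * (w (c + Suc p) * (1 + r) ^ Suc p)) = (1 + r) * ?R (Suc c)"
    unfolding sum_distrib_left by (intro sum.cong refl) (simp add: algebra_simps)
  ultimately show ?case
    unfolding binomial_sum_Suc Suc.IH by (simp add: algebra_simps)
qed

section \<open>From Steiner coefficients to quermassintegrals\<close>

lemma outer_outer:
  assumes "convex E" "0 \<le> r"
  shows "outer (M + E) E r = outer M E (1 + r)"
proof -
  have "E + (\<lambda>x. r *\<^sub>R x) ` E = (\<lambda>x. (1 + r) *\<^sub>R x) ` E"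
  proof (intro subset_antisym subsetI)
    fix x assume "x \<in> E + (\<lambda>x. r *\<^sub>R x) ` E"
    then obtain p q where pq: "p \<in> E" "q \<in> E" "x = p + r *\<^sub>R q"
      by (auto elim!: set_plus_elim)
    \<comment> \<open>Convexity of \<open>E\<close> enters here: after division by
      \<open>1 + r\<close> the sum is a convex combination.\<close>
    have "(1 / (1 + r)) *\<^sub>R p + (r / (1 + r)) *\<^sub>R q \<in> E"
      using assms pq by (intro convexD[OF assms(1)]) (auto simp: field_simps)
    moreover have "x = (1 + r) *\<^sub>R ((1 / (1 + r)) *\<^sub>R p + (r / (1 + r)) *\<^sub>R q)"
      using assms(2) pq(3) by (simp add: scaleR_add_right)
    ultimately show "x \<in> (\<lambda>x. (1 + r) *\<^sub>R x) ` E" by blast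
  next
    fix x assume "x \<in> (\<lambda>x. (1 + r) *\<^sub>R x) ` E"
    then show "x \<in> E + (\<lambda>x. r *\<^sub>R x) ` E" by (auto simp: scaleR_add_left intro!: set_plus_intro)
  qed
  then show ?thesis by (simp add: add.assoc)
qed

text \<open>Uniqueness of polynomial coefficients makes the definite description in
  \<open>quermassintegral\<close> denote; beyond the dimension the witness must be extended by
  \<open>0\<close>, as the definition demands.\<close>

lemma quermassintegral_eqI:
  fixes K E :: "'a::euclidean_space set"
  assumes "\<And>r. 0 \<le> r \<Longrightarrow> measure lebesgue (outer K E r) = (\<Sum>i\<le>DIM('a). real (DIM('a) choose i) * (w i * r ^ i))"
    and "i \<le> DIM('a)"
  shows "quermassintegral K E i = w i"
proof -
  let ?n = "DIM('a)"
  let ?w = "\<lambda>i. if i \<le> ?n then w i else 0"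
  have "quermassintegral K E = ?w"
    unfolding quermassintegral_def
  proof (rule the_equality)
    show "(\<forall>r\<ge>0. measure lebesgue (outer K E r) = (\<Sum>i = 0..?n. real (?n choose i) * ?w i * r ^ i))
        \<and> (\<forall>i>?n. ?w i = 0)"
      using assms(1) by (simp add: atMost_atLeast0 mult.assoc)
  next
    fix v assume v: "(\<forall>r\<ge>0. measure lebesgue (outer K E r) = (\<Sum>i = 0..?n. real (?n choose i) * v i * r ^ i))
        \<and> (\<forall>i>?n. v i = 0)"
    show "v = ?w"
    proof
      fix i
      show "v i = ?w i"
      proof (cases "i \<le> ?n")
        case True
        have "real (?n choose i) * v i = real (?n choose i) * w i"
        proof (rule polynomial_coeffs_unique[OF _ True])
          fix r :: real assume "0 < r"
          then show "(\<Sum>i\<le>?n. real (?n choose i) * v i * r ^ i) = (\<Sum>i\<le>?n. real (?n choose i) * w i * r ^ i)"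
            using v assms(1)[of r] by (simp add: atMost_atLeast0 mult.assoc)
        qed
        then show ?thesis using True by simp
      qed (use v in auto)
    qed
  qed
  then show ?thesis using assms(2) by simp
qed

text \<open>The dimension bound is taken in the integers: for \<open>j = n\<close> it reads
  \<open>aff_dim M \<le> - 1\<close>, which fails for every nonempty \<open>M\<close>, whereas
  truncated subtraction would yield \<open>0\<close>.\<close>

theorem proposition3p1:
  fixes M E K :: "(real ^ 'n) set" and n :: nat and f :: "nat \<Rightarrow> nat \<Rightarrow> real"
  assumes "n = CARD('n)"
    and "convex_body M" and "convex_body E" and "aff_dim E = int n"
    and "K = M + E"
    and "\<And>i j. i \<le> j \<Longrightarrow> j \<le> n \<Longrightarrow>
           f i j = (\<Sum>k = 0..n - j. real ((n - j) choose k) * (- 1) ^ k * quermassintegral K E (i + k))"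
  shows "\<forall>i j. i \<le> j \<and> j \<le> n \<longrightarrow>
           0 \<le> f i j \<and> (f i j = 0 \<longleftrightarrow> aff_dim M \<le> int n - int j - 1)"
proof -
  have n: "DIM(real^'n) = n" using assms(1) by simp
  obtain w where w: "\<And>i. i \<le> n \<Longrightarrow> 0 \<le> w i"
    "\<And>i. i \<le> n \<Longrightarrow> w i = 0 \<longleftrightarrow> aff_dim M \<le> int n - int i - 1"
    "\<And>r. 0 < r \<Longrightarrow> measure lebesgue (outer M E r) = (\<Sum>i\<le>n. real (n choose i) * (w i * r ^ i))"
    using steiner_polynomial[OF assms(2,3), unfolded n, OF assms(4)] by blast
  \<comment> \<open>The polynomial of \<open>M\<close> is evaluated at \<open>1 + r\<close>, which
    is positive also for \<open>r = 0\<close>.\<close>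
  have "measure lebesgue (outer K E r) = (\<Sum>i\<le>n. real (n choose i) * (binomial_transform w (n - i) i * r ^ i))"
    if "0 \<le> r" for r
    using that w(3)[of "1 + r"] binomial_transform_shift[where c = 0] assms(3)
    by (simp add: assms(5) outer_outer convex_body_def)
  then have W: "quermassintegral K E i = binomial_transform w (n - i) i" if "i \<le> n" for i
    using quermassintegral_eqI[where K = K and E = E and w = "\<lambda>i. binomial_transform w (n - i) i" and i = i] that
    unfolding n by blast
  have f: "f i j = binomial_transform w (j - i) i" if "i \<le> j" "j \<le> n" for i j
  proof -
    \<comment> \<open>The number \<open>n - (i + k)\<close> of binomial steps is split as
      \<open>a + d - k\<close> with \<open>a = j - i\<close> and \<open>d = n - j\<close>, so that
      the alternating sum undoes \<open>d\<close> of them.\<close>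
    have "f i j = (\<Sum>k\<le>n - j. real ((n - j) choose k) *
        ((- 1) ^ k * binomial_transform w (j - i + (n - j) - k) (i + k)))"
      unfolding assms(6)[OF that] atMost_atLeast0
      using that by (intro sum.cong refl) (simp add: W mult.assoc)
    then show ?thesis by (simp add: alternating_binomial_transform)
  qed
  show ?thesis
  proof (intro allI impI)
    fix i j assume ij: "i \<le> j \<and> j \<le> n"
    have nn: "0 \<le> real ((j - i) choose l) * w (i + l)" if "l \<in> {..j - i}" for l
    proof -
      have "i + l \<le> n" using that ij unfolding atMost_iff by linarith
      then show ?thesis using w(1) by simp
    qed
    have fij: "f i j = (\<Sum>l\<le>j - i. real ((j - i) choose l) * w (i + l))"
      using f ij unfolding binomial_transform_def by blast
    have "f i j = 0 \<longleftrightarrow> (\<forall>l\<in>{..j - i}. real ((j - i) choose l) * w (i + l) = 0)"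
      unfolding fij by (rule sum_nonneg_eq_0_iff[OF finite_atMost nn])
    also have "\<dots> \<longleftrightarrow> (\<forall>l\<in>{..j - i}. aff_dim M \<le> int n - int (i + l) - 1)"
    proof (intro ball_cong refl)
      fix l assume l: "l \<in> {..j - i}"
      then have "i + l \<le> n" using ij unfolding atMost_iff by linarith
      then show "real ((j - i) choose l) * w (i + l) = 0 \<longleftrightarrow> aff_dim M \<le> int n - int (i + l) - 1"
        using w(2)[of "i + l"] l by simp
    qed
    \<comment> \<open>The bounds tighten as \<open>l\<close> grows, so the last index
      \<open>l = j - i\<close> implies all others.\<close>
    also have "\<dots> \<longleftrightarrow> aff_dim M \<le> int n - int j - 1"
    proof
      assume "\<forall>l\<in>{..j - i}. aff_dim M \<le> int n - int (i + l) - 1"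
      from bspec[OF this, of "j - i"] show "aff_dim M \<le> int n - int j - 1" using ij by simp
    qed (use ij in auto)
    finally show "0 \<le> f i j \<and> (f i j = 0 \<longleftrightarrow> aff_dim M \<le> int n - int j - 1)"
      unfolding fij by (intro conjI sum_nonneg nn)
  qed
qed

end
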